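(* Let $f$ be a transcendental meromorphic function on $\mathbb{C}$ with a non-zero Picard exceptional value, and let $k$ be a positive integer. If $f f^{(k)}$ is a periodic function, then $f$ is also a periodic function.
   Context: Meromorphic means meromorphic in the whole complex plane $\mathbb{C}$; transcendental means not a rational function. A non-zero Picard exceptional value of $f$ is a value $\eta\in\mathbb{C}\setminus\{0\}$ that $f$ does not take in $\mathbb{C}$. A meromorphic function $h$ is periodic if there is a constant $c\in\mathbb{C}\setminus\{0\}$ with $h(z+c)\equiv h(z)$; such $c$ is called a period. $f^{(k)}$ denotes the $k$-th derivative of $f$. *)

theory Defs
  imports "HOL-Complex_Analysis.Complex_Analysis"
begin

text \<open>
  Identities between meromorphic functions are read off a sparse set, so that they do not
  depend on the values which HOL functions have at poles and removable singularities.
\<close>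

definition rational_fun :: "(complex \<Rightarrow> complex) \<Rightarrow> bool" where
  "rational_fun f \<longleftrightarrow>
     (\<exists>p q :: complex poly. q \<noteq> 0 \<and> (\<forall>\<^sub>\<approx>z\<in>UNIV. f z = poly p z / poly q z))"

text \<open>
  Normalising by \<^const>\<open>nicely_meromorphic_on\<close> is no restriction: it only fixes the
  representing HOL function (removable singularities are filled in, the value at a pole is 0).
\<close>

definition transcendental_meromorphic :: "(complex \<Rightarrow> complex) \<Rightarrow> bool" where
  "transcendental_meromorphic f \<longleftrightarrow> f nicely_meromorphic_on UNIV \<and> \<not> rational_fun f"

text \<open>The value of the HOL function at a pole is a convention and does not count as taken.\<close>

definition picard_exceptional :: "(complex \<Rightarrow> complex) \<Rightarrow> complex \<Rightarrow> bool" where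
  "picard_exceptional f \<eta> \<longleftrightarrow> (\<forall>z. \<not> is_pole f z \<longrightarrow> f z \<noteq> \<eta>)"

text \<open>
  If \<open>h\<close> is nicely meromorphic, then \<open>h (z + c) = h z\<close> off a sparse set already implies it for
  all \<open>z\<close>.
\<close>

definition periodic_meromorphic :: "(complex \<Rightarrow> complex) \<Rightarrow> bool" where
  "periodic_meromorphic h \<longleftrightarrow>
     h meromorphic_on UNIV \<and> (\<exists>c. c \<noteq> 0 \<and> (\<forall>\<^sub>\<approx>z\<in>UNIV. h (z + c) = h z))"

end

theory Submission
  imports Defs "HOL-Real_Asymp.Real_Asymp"
begin

text \<open>
  Let \<open>c\<close> be a period of \<open>H = f f\<^sup>(\<^sup>k\<^sup>)\<close>. Then every translate \<open>f\<^sub>n(z) = f(z + n c)\<close> solves the same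
  differential equation \<open>y y\<^sup>(\<^sup>k\<^sup>) = H\<close> and omits the same value \<open>\<eta>\<close>. The claim is that two of these
  translates coincide; why this is so depends on whether \<open>f\<close> has poles.

  Suppose that \<open>f\<close> has a pole \<open>z0\<close>. The equation determines the Laurent expansion of a solution with
  a pole at \<open>z0\<close> up to a sign and, only for odd \<open>k\<close>, one further parameter. So two of \<open>f\<^sub>0\<close>, \<open>f\<^sub>1\<close>, \<open>f\<^sub>2\<close>
  have the same sign and can differ only in the parameter. For odd \<open>k\<close> the function \<open>2 y y\<^sup>(\<^sup>k\<^sup>)\<close> has
  an explicit primitive \<open>W(y)\<close>, quadratic in the derivatives of \<open>y\<close>, and the parameter is visible in
  \<open>W(y)\<close> (\<open>fls_same_lead_imp_concomitant_neq\<close>). As \<open>H\<close> is periodic, \<open>W(f\<^sub>n) = W(f) + n A\<close> for a constant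
  \<open>A\<close>, with \<open>A \<noteq> 0\<close> if the parameters differ. On a small punctured disc around \<open>z0\<close> the function \<open>H\<close>
  has no zeros, so all \<open>f\<^sub>n\<close> omit both 0 and \<open>\<eta>\<close> there, and by Schottky's theorem they are uniformly
  bounded on an annulus (\<open>punctured_disc_family_bounded\<close>). This contradicts \<open>A \<noteq> 0\<close>.

  Suppose that \<open>f\<close> is entire. Then \<open>f = \<eta> + exp \<beta>\<close> and \<open>f\<^sub>1 = \<eta> + exp \<gamma>\<close>, and the equation becomes
  \<open>P u (u + \<eta>) = R v (v + \<eta>)\<close> for \<open>u = exp \<beta>\<close>, \<open>v = exp \<gamma>\<close> and differential polynomials \<open>P\<close>, \<open>R\<close> in
  \<open>\<beta>\<close> and \<open>\<gamma>\<close>. Eliminating \<open>v\<close> with the help of the derivative of this relation shows that \<open>u\<close> is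
  algebraic over differential polynomials unless \<open>\<beta>' = \<gamma>'\<close> and \<open>P = R\<close> (\<open>elimination\<close>,
  \<open>elim_coeffs_zero\<close>). But differential polynomials in \<open>\<beta>\<close> and \<open>\<gamma>\<close> grow only like powers of \<open>\<beta>\<close> and
  \<open>\<gamma>\<close>, not like exponentials; this classical argument of Borel is carried out with maximum moduli
  instead of Nevanlinna characteristics (\<open>algebraic_over_small_bound\<close>, \<open>log_growth_contradiction\<close>). So
  \<open>\<beta>' = \<gamma>'\<close> and \<open>P = R\<close>, and \<open>u = v\<close> follows.
\<close>

unbundle fps_syntax

section \<open>Laurent series with equal products\<close>

text \<open>
  The falling factorial over \<open>int\<close>: the factor by which a \<open>k\<close>-fold derivative multiplies the
  monomial of (possibly negative) degree \<open>q\<close>.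
\<close>

definition falling :: "int \<Rightarrow> nat \<Rightarrow> int" where
  "falling q k = (\<Prod>i<k. q - int i)"

lemma fls_nth_higher_deriv:
  fixes F :: "complex fls"
  shows "((fls_deriv ^^ k) F) $$ n = of_int (falling (n + int k) k) * F $$ (n + int k)"
proof (induction k arbitrary: n)
  case 0
  show ?case by (simp add: falling_def)
next
  case (Suc k)
  have "((fls_deriv ^^ Suc k) F) $$ n = of_int (n + 1) * ((fls_deriv ^^ k) F) $$ (n + 1)"
    by simp
  also have "\<dots> = of_int ((n + 1) * falling (n + 1 + int k) k) * F $$ (n + 1 + int k)"
    by (simp only: Suc of_int_mult mult.assoc)
  also have "(n + 1) * falling (n + 1 + int k) k = falling (n + int (Suc k)) (Suc k)"
    by (simp add: falling_def lessThan_Suc mult.commute algebra_simps)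
  finally show ?case by (simp add: algebra_simps)
qed

lemma falling_neg: "falling (- p) k = (-1) ^ k * (\<Prod>i<k. p + int i)"
proof -
  have "falling (- p) k = (\<Prod>i<k. (-1) * (p + int i))"
    unfolding falling_def by (intro prod.cong) auto
  then show ?thesis by (simp only: prod.distrib) simp
qed

lemma falling_pos:
  assumes "int k \<le> q" shows "falling q k > 0"
  unfolding falling_def using assms by (intro prod_pos) auto

lemma falling_eq_0:
  assumes "0 \<le> q" "q < int k" shows "falling q k = 0"
  unfolding falling_def using assms by (intro prod_zero bexI[of _ "nat q"]) auto

lemma falling_neg_sgn:
  assumes "p > 0" shows "(-1) ^ k * falling (- p) k > 0"
proof -
  have "(-1) ^ k * falling (- p) k = (\<Prod>i<k. p + int i)"
    by (simp add: falling_neg flip: mult.assoc power_add mult_2)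
  also have "\<dots> > 0" using assms by (intro prod_pos) auto
  finally show ?thesis .
qed

text \<open>
  This is the indicial equation at a pole of order \<open>p\<close> of the operator \<open>y y\<^sup>(\<^sup>k\<^sup>)\<close>. If \<open>q < k\<close>, then
  \<open>falling q k\<close> is zero or has the sign of \<open>falling (- p) k\<close>, so that the sum cannot vanish; for
  \<open>q \<ge> k\<close> it is positive, which forces \<open>k\<close> to be odd, and both sides are products of \<open>k\<close>
  consecutive positive integers, which are equal only if they start at the same integer.
\<close>

lemma falling_resonance:
  assumes p: "p > 0" and q: "q > - p" and k: "k > 0"
    and eq: "falling q k + falling (- p) k = 0"
  shows "odd k \<and> q = p + int k - 1"
proof -
  have s: "(-1) ^ k * falling (- p) k > 0" by (rule falling_neg_sgn[OF p])
  have "int k \<le> q"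
  proof (rule ccontr)
    assume "\<not> int k \<le> q"
    then consider "0 \<le> q" "q < int k" | "q < 0" by linarith
    then show False
    proof cases
      case 1 then show False using falling_eq_0[of q k] eq s by auto
    next
      case 2
      have "(-1) ^ k * falling (- (- q)) k > 0" by (rule falling_neg_sgn) (use 2 in simp)
      then have "(-1) ^ k * (falling q k + falling (- p) k) > 0"
        using s by (simp add: distrib_left)
      then show False using eq by simp
    qed
  qed
  then have pos: "falling q k > 0" by (rule falling_pos)
  have odd: "odd k"
  proof
    assume "even k" then show False using s pos eq by simp
  qed
  have e1: "falling q k = (\<Prod>i<k. p + int i)" using eq odd by (simp add: falling_neg)
  have "falling q k = (\<Prod>i<k. q - int (k - Suc i))"
    unfolding falling_def by (rule prod.nat_diff_reindex[symmetric])
  also have "\<dots> = (\<Prod>i<k. (q - int k + 1) + int i)"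
    by (intro prod.cong) (auto simp: of_nat_diff)
  finally have e2: "(\<Prod>i<k. (q - int k + 1) + int i) = (\<Prod>i<k. p + int i)" using e1 by simp
  have lt: "(\<Prod>i<k. a + int i) < (\<Prod>i<k. b + int i)" if "0 < a" "a < b" for a b
    using that k by (intro prod_mono_strict) (auto intro!: exI[of _ 0])
  have "q - int k + 1 = p"
    using lt[of "q - int k + 1" p] lt[of p "q - int k + 1"] e2 \<open>int k \<le> q\<close> p by linarith
  with odd show ?thesis by simp
qed

lemma fls_times_lowest:
  fixes F G :: "complex fls"
  assumes F: "\<And>i. i < a \<Longrightarrow> F $$ i = 0" and G: "\<And>i. i < b \<Longrightarrow> G $$ i = 0"
  shows "(F * G) $$ (a + b) = F $$ a * G $$ b"
proof (cases "F = 0 \<or> G = 0")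
  case True then show ?thesis by auto
next
  case False
  have "a \<le> fls_subdegree F"
    by (rule fls_subdegree_geI) (use False F in auto)
  have "b \<le> fls_subdegree G"
    by (rule fls_subdegree_geI) (use False G in auto)
  with \<open>a \<le> _\<close> consider "a = fls_subdegree F" "b = fls_subdegree G"
    | "a < fls_subdegree F" | "b < fls_subdegree G" by linarith
  then show ?thesis
  proof cases
    case 1 then show ?thesis by simp
  qed (use \<open>a \<le> _\<close> \<open>b \<le> _\<close> in \<open>simp_all add: fls_times_nth_eq0\<close>)
qed

lemma fls_times_below:
  fixes F G :: "complex fls"
  assumes F: "\<And>i. i < a \<Longrightarrow> F $$ i = 0" and G: "\<And>i. i < b \<Longrightarrow> G $$ i = 0" and "n < a + b"
  shows "(F * G) $$ n = 0"
proof (cases "F = 0 \<or> G = 0")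
  case True then show ?thesis by auto
next
  case False
  have "a \<le> fls_subdegree F"
    by (rule fls_subdegree_geI) (use False F in auto)
  have "b \<le> fls_subdegree G"
    by (rule fls_subdegree_geI) (use False G in auto)
  with \<open>a \<le> _\<close> show ?thesis using \<open>n < a + b\<close> by (intro fls_times_nth_eq0) linarith
qed

lemma fls_higher_deriv_below:
  fixes F :: "complex fls"
  assumes "\<And>i. i < a \<Longrightarrow> F $$ i = 0" "n < a - int k"
  shows "((fls_deriv ^^ k) F) $$ n = 0"
  using assms by (simp add: fls_nth_higher_deriv)

lemma fls_higher_deriv_diff:
  "(fls_deriv ^^ k) (F - G :: complex fls) = (fls_deriv ^^ k) F - (fls_deriv ^^ k) G"
  by (intro fls_eqI) (simp add: fls_nth_higher_deriv algebra_simps)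

text \<open>
  At a pole of order \<open>p\<close> the lowest term of \<open>F F\<^sup>(\<^sup>k\<^sup>)\<close> has degree \<open>- 2 p - k\<close>, and its coefficient is
  the square of the leading coefficient of \<open>F\<close> times a non-zero integer: negative exponents are not
  killed by differentiation. So the product remembers the order of the pole, and the leading
  coefficient up to sign.
\<close>

lemma fls_pole_lead_square:
  fixes F G :: "complex fls"
  assumes eq: "G * (fls_deriv ^^ k) G = F * (fls_deriv ^^ k) F" and neg: "fls_subdegree F < 0"
  shows "fls_subdegree G = fls_subdegree F"
    and "(G $$ fls_subdegree F)\<^sup>2 = (F $$ fls_subdegree F)\<^sup>2"
proof -
  have nz: "falling m k \<noteq> 0" if "m < 0" for m
    using falling_neg_sgn[of "- m" k] that by auto
  have lead: "(F * (fls_deriv ^^ k) F) $$ (2 * m - int k) = of_int (falling m k) * (F $$ m)\<^sup>2"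
    if "m \<le> fls_subdegree F" for m and F :: "complex fls"
  proof -
    have "(F * (fls_deriv ^^ k) F) $$ (m + (m - int k))
          = F $$ m * ((fls_deriv ^^ k) F) $$ (m - int k)"
      using that by (intro fls_times_lowest fls_higher_deriv_below[where a = m]) auto
    moreover have "((fls_deriv ^^ k) F) $$ (m - int k) = of_int (falling m k) * F $$ m"
      by (simp add: fls_nth_higher_deriv)
    moreover have "m + (m - int k) = 2 * m - int k" by simp
    ultimately show ?thesis by (simp only: power2_eq_square mult.left_commute)
  qed
  have lead_nz: "F $$ fls_subdegree F \<noteq> 0" if "fls_subdegree F < 0" for F :: "complex fls"
  proof -
    have "F \<noteq> 0" using that by auto
    then show ?thesis by (rule nth_fls_subdegree_nonzero)
  qed
  note lF = lead_nz[OF neg]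
  have H0: "(F * (fls_deriv ^^ k) F) $$ (2 * fls_subdegree F - int k) \<noteq> 0"
    using lead[OF order_refl, of F] nz[OF neg] lF by simp
  have le: "fls_subdegree F \<le> fls_subdegree G" if "fls_subdegree G < 0"
  proof (rule ccontr)
    assume "\<not> ?thesis"
    then have "fls_subdegree G < fls_subdegree F" by simp
    then have "(F * (fls_deriv ^^ k) F) $$ (2 * fls_subdegree G - int k) = 0"
      by (intro fls_times_below[where a = "fls_subdegree F" and b = "fls_subdegree F - int k"]
            fls_higher_deriv_below[where a = "fls_subdegree F"]) auto
    moreover note lead_nz[OF that]
    ultimately show False
      using lead[of "fls_subdegree G" G] nz[OF that] eq by simp
  qed
  have ge: "fls_subdegree F \<le> fls_subdegree G" using le neg by fastforce
  from lead[of "fls_subdegree F" G] lead[of "fls_subdegree F" F] ge eq nz[OF neg]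
  show sq: "(G $$ fls_subdegree F)\<^sup>2 = (F $$ fls_subdegree F)\<^sup>2" by simp
  then have "G $$ fls_subdegree F \<noteq> 0" using lF by auto
  then show "fls_subdegree G = fls_subdegree F" using ge fls_subdegree_leI[of G] by force
qed

text \<open>
  For odd \<open>k\<close> the expression \<open>2 F F\<^sup>(\<^sup>k\<^sup>)\<close> is an exact derivative. This is its primitive, obtained by
  repeated integration by parts (the bilinear concomitant of \<open>y\<^sup>(\<^sup>k\<^sup>)\<close>, on the diagonal).
\<close>

definition fls_concomitant :: "nat \<Rightarrow> complex fls \<Rightarrow> complex fls" where
  "fls_concomitant k F = (\<Sum>i<k. (-1) ^ i * (fls_deriv ^^ i) F * (fls_deriv ^^ (k - 1 - i)) F)"

lemma fls_minus_one_power_times_nth: "((-1) ^ i * (F :: complex fls)) $$ n = (-1) ^ i * F $$ n"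
  by (cases "even i") auto

text \<open>
  Write \<open>G = F + S\<close> with \<open>S\<close> of order \<open>q > - p\<close>. In \<open>G G\<^sup>(\<^sup>k\<^sup>) - F F\<^sup>(\<^sup>k\<^sup>)\<close> the terms linear in \<open>S\<close>
  dominate, so that their coefficient must vanish, which is the indicial equation. For its only
  root \<open>q = p + k - 1\<close> the terms of the concomitant that are linear in \<open>S\<close> begin in degree 0, and
  there all summands have the same sign, so nothing cancels: the constant term of the concomitant measures
  the one parameter that the equation leaves free.
\<close>

lemma fls_same_lead_imp_concomitant_neq:
  fixes F G :: "complex fls"
  assumes eq: "G * (fls_deriv ^^ k) G = F * (fls_deriv ^^ k) F" and neg: "fls_subdegree F < 0"
    and lead: "G $$ fls_subdegree F = F $$ fls_subdegree F" and "F \<noteq> G" and k: "k > 0"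
  shows "odd k \<and> fls_concomitant k G $$ 0 \<noteq> fls_concomitant k F $$ 0"
proof -
  define S p q where "S = G - F" and "p = - fls_subdegree F" and "q = fls_subdegree S"
  have p: "p > 0" using neg by (simp add: p_def)
  have sG: "fls_subdegree G = - p" using fls_pole_lead_square(1)[OF eq neg] by (simp add: p_def)
  have sF: "fls_subdegree F = - p" by (simp add: p_def)
  have S0: "S \<noteq> 0" using \<open>F \<noteq> G\<close> by (simp add: S_def)
  have q: "q > - p"
    unfolding q_def
  proof (rule fls_subdegree_greaterI[OF S0])
    fix n assume "n \<le> - p"
    then consider "n < - p" | "n = - p" by linarith
    then show "S $$ n = 0" by cases (use lead sG sF in \<open>auto simp: S_def\<close>)
  qed
  define a b where "a = G $$ (- p)" and "b = S $$ q"
  have "G \<noteq> 0" using sG p by auto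
  then have a: "a \<noteq> 0" unfolding a_def using nth_fls_subdegree_nonzero[of G] sG by simp
  have b: "b \<noteq> 0" unfolding b_def q_def using S0 by simp
  have Gb: "G $$ n = 0" if "n < - p" for n using that sG by simp
  have Sb: "S $$ n = 0" if "n < q" for n using that by (simp add: q_def)
  have dG: "((fls_deriv ^^ j) G) $$ (- p - int j) = of_int (falling (- p) j) * a" for j
    by (simp add: fls_nth_higher_deriv a_def)
  have dS: "((fls_deriv ^^ j) S) $$ (q - int j) = of_int (falling q j) * b" for j
    by (simp add: fls_nth_higher_deriv b_def)
  have dGb: "((fls_deriv ^^ j) G) $$ n = 0" if "n < - p - int j" for n j
    using fls_higher_deriv_below Gb that by blast
  have dSb: "((fls_deriv ^^ j) S) $$ n = 0" if "n < q - int j" for n j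
    using fls_higher_deriv_below Sb that by blast
  \<comment> \<open>as \<open>q > - p\<close>, the term quadratic in \<open>S\<close> has too high an order to contribute\<close>
  have prod: "((fls_deriv ^^ i) G * (fls_deriv ^^ j) G - (fls_deriv ^^ i) F * (fls_deriv ^^ j) F)
                $$ (q - p - int (i + j))
              = of_int (falling q i * falling (- p) j + falling (- p) i * falling q j) * (a * b)"
    for i j
  proof -
    have Fd: "(fls_deriv ^^ m) F = (fls_deriv ^^ m) G - (fls_deriv ^^ m) S" for m
      by (simp add: S_def flip: fls_higher_deriv_diff)
    have "(fls_deriv ^^ i) G * (fls_deriv ^^ j) G - (fls_deriv ^^ i) F * (fls_deriv ^^ j) F
        = (fls_deriv ^^ i) S * (fls_deriv ^^ j) G + (fls_deriv ^^ i) G * (fls_deriv ^^ j) S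
          - (fls_deriv ^^ i) S * (fls_deriv ^^ j) S"
      unfolding Fd by (simp add: algebra_simps)
    moreover have "((fls_deriv ^^ i) S * (fls_deriv ^^ j) G) $$ ((q - int i) + (- p - int j))
        = of_int (falling q i) * b * (of_int (falling (- p) j) * a)"
      using dGb dSb by (subst fls_times_lowest) (auto simp only: dG dS)
    moreover have "((fls_deriv ^^ i) G * (fls_deriv ^^ j) S) $$ ((- p - int i) + (q - int j))
        = of_int (falling (- p) i) * a * (of_int (falling q j) * b)"
      using dGb dSb by (subst fls_times_lowest) (auto simp only: dG dS)
    moreover have "((fls_deriv ^^ i) S * (fls_deriv ^^ j) S) $$ (q - p - int (i + j)) = 0"
      using dSb q by (intro fls_times_below[where a = "q - int i" and b = "q - int j"]) auto
    moreover have "(q - int i) + (- p - int j) = q - p - int (i + j)"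
      "(- p - int i) + (q - int j) = q - p - int (i + j)" by auto
    ultimately show ?thesis
      by (simp only: fls_plus_nth fls_minus_nth) (simp add: algebra_simps)
  qed
  from prod[of 0 k] eq a b have "falling q k + falling (- p) k = 0"
    by (simp add: falling_def add.commute flip: of_int_add)
  from falling_resonance[OF p q k this] have odd: "odd k" and qk: "q = p + int k - 1" by auto
  define c :: int where "c = (\<Sum>i<k. (-1) ^ i * (falling q i * falling (- p) (k - 1 - i)
                              + falling (- p) i * falling q (k - 1 - i)))"
  have "c > 0"
    unfolding c_def
  proof (rule sum_pos)
    fix i assume "i \<in> {..<k}"
    then have i: "i < k" by simp
    have par: "(-1 :: int) ^ i = (-1) ^ (k - 1 - i)"
      using i odd by (auto simp: minus_one_power_iff)
    have "falling q i > 0" "falling q (k - 1 - i) > 0"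
      using i p qk by (auto intro!: falling_pos)
    moreover have "(-1) ^ i * falling (- p) i > 0" "(-1) ^ i * falling (- p) (k - 1 - i) > 0"
      using falling_neg_sgn[OF p, of i] falling_neg_sgn[OF p, of "k - 1 - i"] by (simp_all only: par)
    ultimately have "falling q i * ((-1) ^ i * falling (- p) (k - 1 - i)) > 0"
      "((-1) ^ i * falling (- p) i) * falling q (k - 1 - i) > 0" by (auto intro: mult_pos_pos)
    then show "(-1) ^ i * (falling q i * falling (- p) (k - 1 - i)
        + falling (- p) i * falling q (k - 1 - i)) > 0"
      by (simp add: algebra_simps)
  qed (use k in auto)
  have "(fls_concomitant k G - fls_concomitant k F) $$ 0
      = (\<Sum>i<k. (-1) ^ i * ((fls_deriv ^^ i) G * (fls_deriv ^^ (k - 1 - i)) G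
          - (fls_deriv ^^ i) F * (fls_deriv ^^ (k - 1 - i)) F)) $$ 0"
    by (simp add: fls_concomitant_def right_diff_distrib mult.assoc flip: sum_subtractf)
  also have "\<dots> = (\<Sum>i<k. (-1) ^ i * ((fls_deriv ^^ i) G * (fls_deriv ^^ (k - 1 - i)) G
          - (fls_deriv ^^ i) F * (fls_deriv ^^ (k - 1 - i)) F) $$ (q - p - int (i + (k - 1 - i))))"
  proof -
    have nth_sum: "(\<Sum>i\<in>I. f i) $$ n = (\<Sum>i\<in>I. f i $$ n)" for f :: "nat \<Rightarrow> complex fls" and I n
      by (induction I rule: infinite_finite_induct) auto
    have "q - p - int (i + (k - 1 - i)) = 0" if "i < k" for i
      using that qk by (simp add: of_nat_diff)
    then show ?thesis
      unfolding nth_sum by (intro sum.cong refl) (simp add: fls_minus_one_power_times_nth)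
  qed
  also have "\<dots> = of_int c * (a * b)"
    unfolding prod c_def of_int_sum sum_distrib_right
    by (intro sum.cong refl) (simp add: mult.assoc)
  finally have "(fls_concomitant k G - fls_concomitant k F) $$ 0 \<noteq> 0"
    using \<open>c > 0\<close> a b by simp
  with odd show ?thesis by auto
qed

section \<open>Functions omitting two values near a pole\<close>

text \<open>
  A function that omits 0 and \<open>\<eta>\<close> on a punctured disc becomes, after composition with
  \<open>\<zeta> \<mapsto> z0 + (w0 - z0) exp \<zeta>\<close>, a function on a half plane. If \<open>w0\<close> is close enough to \<open>z0\<close>, the
  half plane contains a disc around 0 whose concentric half-size disc still covers a whole annulus
  around \<open>z0\<close>; one application of Schottky's theorem then bounds the function on this annulus by its
  value at \<open>w0\<close>, uniformly in the position of \<open>w0\<close> on the circle. The radius factor \<open>exp (- 12)\<close>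
  leaves room for a disc of radius 11 in the half plane, and the logarithms needed have modulus
  at most 5.
\<close>

lemma annulus_bounded_of_bounded_on_circle_point:
  fixes g :: "complex \<Rightarrow> complex"
  assumes \<eta>: "\<eta> \<noteq> 0" and \<rho>: "\<rho> > 0"
    and hol: "g holomorphic_on ball z0 \<rho> - {z0}"
    and omit: "\<And>z. z \<in> ball z0 \<rho> - {z0} \<Longrightarrow> g z \<noteq> 0 \<and> g z \<noteq> \<eta>"
    and w0: "dist z0 w0 = \<rho> * exp (- 12)" "norm (g w0) \<le> C"
    and z: "\<rho> * exp (- 12) / 2 \<le> dist z0 z" "dist z0 z \<le> 2 * (\<rho> * exp (- 12))"
  shows "norm (g z) \<le> norm \<eta> * exp (pi * exp (pi * (14 + 2 * (C / norm \<eta>))))"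
proof -
  define \<rho>1 where "\<rho>1 = \<rho> * exp (- 12 :: real)"
  have \<rho>1: "\<rho>1 > 0" using \<rho> by (simp add: \<rho>1_def)
  have n0: "norm (w0 - z0) = \<rho>1" using w0 by (simp add: \<rho>1_def dist_norm norm_minus_commute)
  have nz: "\<rho>1 / 2 \<le> norm (z - z0)" "norm (z - z0) \<le> 2 * \<rho>1"
    using z by (simp_all add: \<rho>1_def dist_norm norm_minus_commute)
  have ne: "w0 \<noteq> z0" "z \<noteq> z0" using n0 nz \<rho>1 by auto
  define E where "E w = z0 + (w0 - z0) * exp (11 * w)" for w :: complex
  have E: "E w \<in> ball z0 \<rho> - {z0}" if "w \<in> cball 0 1" for w
  proof -
    have "Re w \<le> 1" using that complex_Re_le_cmod[of w] by simp
    then have "norm (exp (11 * w)) \<le> exp 11" by simp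
    then have "norm ((w0 - z0) * exp (11 * w)) \<le> \<rho>1 * exp 11"
      unfolding norm_mult n0 using \<rho>1 by simp
    also have "\<dots> = \<rho> * exp (- 1)" by (simp add: \<rho>1_def mult.assoc flip: exp_add)
    also have "\<dots> < \<rho>" using \<rho> by simp
    finally show ?thesis using ne by (simp add: E_def dist_norm)
  qed
  define h where "h w = g (E w) / \<eta>" for w
  have "E holomorphic_on cball 0 1" unfolding E_def by (intro holomorphic_intros)
  moreover have "E ` cball 0 1 \<subseteq> ball z0 \<rho> - {z0}" using E by blast
  ultimately have "(g \<circ> E) holomorphic_on cball 0 1"
    by (intro holomorphic_on_compose_gen[OF _ hol])
  then have holh: "h holomorphic_on cball 0 1"
    unfolding h_def o_def using \<eta> by (intro holomorphic_intros) auto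
  have h0: "norm (h 0) \<le> C / norm \<eta>"
    using w0 \<eta> by (simp add: h_def E_def norm_divide divide_right_mono)
  have h01: "\<not> (h w = 0 \<or> h w = 1)" if "w \<in> cball 0 1" for w
    using omit[OF E[OF that]] \<eta> by (auto simp: h_def)
  define v where "v = Ln ((z - z0) / (w0 - z0)) / 11"
  have qne: "(z - z0) / (w0 - z0) \<noteq> 0" using ne by simp
  have Ev: "E v = z" using qne ne by (simp add: E_def v_def)
  have "norm v \<le> 1 / 2"
  proof -
    have q: "norm ((z - z0) / (w0 - z0)) = norm (z - z0) / \<rho>1" by (simp add: norm_divide n0)
    have "1 / 2 \<le> norm (z - z0) / \<rho>1" "norm (z - z0) / \<rho>1 \<le> 2"
      using nz \<rho>1 by (simp_all add: field_simps)
    then have "ln (1 / 2) \<le> ln (norm (z - z0) / \<rho>1)" "ln (norm (z - z0) / \<rho>1) \<le> ln 2"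
      using \<rho>1 ne by (subst ln_le_cancel_iff; force)+
    then have "\<bar>Re (Ln ((z - z0) / (w0 - z0)))\<bar> \<le> 1"
      using ln_2_less_1 qne by (simp add: q ln_div)
    moreover have "\<bar>Im (Ln ((z - z0) / (w0 - z0)))\<bar> \<le> 4"
      using Im_Ln_le_pi[OF qne] mpi_less_Im_Ln[OF qne] pi_less_4 by linarith
    ultimately have "norm (Ln ((z - z0) / (w0 - z0))) \<le> 5"
      using cmod_le[of "Ln ((z - z0) / (w0 - z0))"] by linarith
    then show ?thesis by (simp add: v_def norm_divide)
  qed
  from Schottky[OF holh h0 h01 _ _ this]
  have "norm (h v) \<le> exp (pi * exp (pi * (14 + 2 * (C / norm \<eta>))))" by simp
  then show ?thesis using \<eta> by (simp add: h_def Ev norm_divide field_simps)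
qed

text \<open>
  Functions omitting 0 and \<open>\<eta>\<close> on a punctured disc need not be uniformly bounded on smaller
  annuli, since they may tend to infinity. This is prevented by a pole of fixed order with a leading
  coefficient of bounded size: \<open>(z - z0)\<^sup>p g\<close> extends without zeros to \<open>z0\<close>, so by the minimum
  principle it is not large everywhere on a circle around \<open>z0\<close>.
\<close>

lemma punctured_disc_family_bounded:
  fixes z0 \<eta> :: complex
  assumes \<eta>: "\<eta> \<noteq> 0" and \<rho>: "\<rho> > 0" and C: "C > 0"
  obtains z1 \<epsilon> B where "\<epsilon> > 0" "cball z1 \<epsilon> \<subseteq> ball z0 \<rho> - {z0}"
    "\<forall>g L. g holomorphic_on ball z0 \<rho> - {z0} \<and> (\<forall>z\<in>ball z0 \<rho> - {z0}. g z \<noteq> 0 \<and> g z \<noteq> \<eta>) \<and>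
       ((\<lambda>z. (z - z0) ^ p * g z) \<longlongrightarrow> L) (at z0) \<and> L \<noteq> 0 \<and> norm L \<le> C \<longrightarrow>
       (\<forall>z\<in>cball z1 \<epsilon>. norm (g z) \<le> B)"
proof -
  define \<rho>1 where "\<rho>1 = \<rho> * exp (- 12 :: real)"
  have \<rho>1: "\<rho>1 > 0" using \<rho> by (simp add: \<rho>1_def)
  have "exp (12::real) \<ge> 1 + 12" by (rule exp_ge_add_one_self)
  then have lt: "2 * \<rho>1 < \<rho>" using \<rho> by (simp add: \<rho>1_def exp_minus field_simps)
  define z1 where "z1 = z0 + of_real \<rho>1"
  have d1: "\<rho>1 / 2 \<le> dist z0 z \<and> dist z0 z \<le> 2 * \<rho>1" if "z \<in> cball z1 (\<rho>1 / 2)" for z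
  proof -
    have "dist z0 z1 = \<rho>1" using \<rho>1 by (simp add: z1_def dist_norm)
    moreover have "dist z1 z \<le> \<rho>1 / 2" using that by simp
    ultimately show ?thesis
      using dist_triangle[of z0 z z1] dist_triangle[of z0 z1 z] dist_commute[of z1 z] \<rho>1 by linarith
  qed
  have sub: "cball z1 (\<rho>1 / 2) \<subseteq> ball z0 \<rho> - {z0}"
    using d1 lt \<rho>1 by fastforce
  have main: "norm (g z) \<le> norm \<eta> * exp (pi * exp (pi * (14 + 2 * ((C / \<rho>1 ^ p) / norm \<eta>))))"
    if hol: "g holomorphic_on ball z0 \<rho> - {z0}"
      and omit: "\<And>z. z \<in> ball z0 \<rho> - {z0} \<Longrightarrow> g z \<noteq> 0 \<and> g z \<noteq> \<eta>"
      and lim: "((\<lambda>z. (z - z0) ^ p * g z) \<longlongrightarrow> L) (at z0)" and L: "L \<noteq> 0" "norm L \<le> C"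
      and z: "z \<in> cball z1 (\<rho>1 / 2)" for g L z
  proof -
    define G where "G z = (if z = z0 then L else (z - z0) ^ p * g z)" for z
    have Gnz: "G z \<noteq> 0" if "z \<in> ball z0 \<rho>" for z
      using omit[of z] L that by (auto simp: G_def)
    have "(\<lambda>z. (z - z0) ^ p * g z) holomorphic_on ball z0 \<rho> - {z0}"
      by (intro holomorphic_intros hol)
    then have "G holomorphic_on ball z0 \<rho> - {z0}"
      by (rule holomorphic_transform) (auto simp: G_def)
    moreover have "(G \<longlongrightarrow> G z0) (at z0 within ball z0 \<rho>)"
    proof -
      have "(G \<longlongrightarrow> L) (at z0)"
        by (rule Lim_transform_eventually[OF lim]) (auto simp: G_def eventually_at_filter)
      then show ?thesis
        using tendsto_within_subset[of G "nhds L" z0 UNIV "ball z0 \<rho>"] by (simp add: G_def)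
    qed
    ultimately have holG: "G holomorphic_on ball z0 \<rho>"
      using no_isolated_singularity'[of "{z0}" G "ball z0 \<rho>"] by (metis finite.emptyI
        finite.insertI open_ball singletonD)
    have "\<exists>w0\<in>sphere z0 \<rho>1. norm (G w0) \<le> C"
    proof (rule ccontr)
      assume "\<not> ?thesis"
      then have gt: "\<And>w. w \<in> sphere z0 \<rho>1 \<Longrightarrow> C < norm (G w)" by (auto simp: not_le)
      have subs: "cball z0 \<rho>1 \<subseteq> ball z0 \<rho>" using lt \<rho>1 by auto
      have cont: "continuous_on (sphere z0 \<rho>1) (\<lambda>w. norm (G w))"
        by (intro continuous_intros holomorphic_on_imp_continuous_on holomorphic_on_subset[OF holG])
          (use subs in auto)
      obtain w1 where w1: "w1 \<in> sphere z0 \<rho>1" "\<And>w. w \<in> sphere z0 \<rho>1 \<Longrightarrow> norm (G w1) \<le> norm (G w)"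
        using continuous_attains_inf[OF _ _ cont] \<rho>1 by auto
      have hol1: "(\<lambda>z. 1 / G z) holomorphic_on ball z0 \<rho>"
        using Gnz by (intro holomorphic_intros holG) auto
      have "norm (1 / G z0) \<le> 1 / norm (G w1)"
      proof (rule maximum_modulus_frontier[where S = "cball z0 \<rho>1"
            and f = "\<lambda>z. 1 / G z" and \<xi> = z0])
        show "(\<lambda>z. 1 / G z) holomorphic_on interior (cball z0 \<rho>1)"
          by (rule holomorphic_on_subset[OF hol1]) (use subs in auto)
        show "continuous_on (closure (cball z0 \<rho>1)) (\<lambda>z. 1 / G z)"
          using subs by (intro holomorphic_on_imp_continuous_on holomorphic_on_subset[OF hol1]) auto
        show "norm (1 / G z) \<le> 1 / norm (G w1)" if "z \<in> frontier (cball z0 \<rho>1)" for z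
        proof -
          have z: "z \<in> sphere z0 \<rho>1" using that by simp
          have "norm (G w1) > 0" using gt[OF w1(1)] C by linarith
          then show ?thesis using w1(2)[OF z] by (simp add: norm_divide frac_le)
        qed
      qed (use \<rho>1 in auto)
      moreover have "norm (G w1) > 0" using gt[OF w1(1)] C by linarith
      ultimately have "norm (G w1) \<le> norm L"
        using L by (simp add: G_def norm_divide field_simps)
      then show False using gt[OF w1(1)] L by simp
    qed
    then obtain w0 where w0: "dist z0 w0 = \<rho>1" "norm (G w0) \<le> C" by auto
    then have "norm (g w0) \<le> C / \<rho>1 ^ p"
      using \<rho>1 by (auto simp: G_def norm_mult norm_power dist_norm norm_minus_commute field_simps)
    then show ?thesis
      using annulus_bounded_of_bounded_on_circle_point[OF \<eta> \<rho> hol omit, of w0 "C / \<rho>1 ^ p" z]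
        w0(1) d1[OF z] by (simp add: \<rho>1_def)
  qed
  show ?thesis
  proof (rule that[of "\<rho>1 / 2" z1])
    show "\<rho>1 / 2 > 0" using \<rho>1 by simp
  qed (use sub main in blast)+
qed

section \<open>A primitive for odd order\<close>

definition concomitant :: "nat \<Rightarrow> (complex \<Rightarrow> complex) \<Rightarrow> complex \<Rightarrow> complex" where
  "concomitant k f z = (\<Sum>i<k. (-1) ^ i * (deriv ^^ i) f z * (deriv ^^ (k - 1 - i)) f z)"

lemma higher_deriv_shift: "(deriv ^^ i) (\<lambda>z. f (z + w)) = (\<lambda>z. (deriv ^^ i) f (z + w))"
  for f :: "complex \<Rightarrow> complex"
proof (induction i)
  case (Suc i)
  have "deriv (\<lambda>z. (deriv ^^ i) f (z + w)) z = deriv ((deriv ^^ i) f) (z + w)" for z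
    by (simp add: deriv_def DERIV_shift)
  then show ?case by (simp add: Suc)
qed simp

lemma concomitant_shift: "concomitant k (\<lambda>z. f (z + w)) z = concomitant k f (z + w)"
  by (simp add: concomitant_def higher_deriv_shift)

text \<open>
  The sum telescopes after differentiation to \<open>f f\<^sup>(\<^sup>k\<^sup>) - (-1)\<^sup>k f\<^sup>(\<^sup>k\<^sup>) f\<close>, which doubles for odd \<open>k\<close>
  and would vanish for even \<open>k\<close>.
\<close>

lemma concomitant_has_field_derivative:
  assumes hol: "f holomorphic_on S" "open S" "z \<in> S" and k: "odd k"
  shows "(concomitant k f has_field_derivative 2 * f z * (deriv ^^ k) f z) (at z)"
proof -
  define D where "D i = (deriv ^^ i) f" for i
  have D: "(D i has_field_derivative D (Suc i) z) (at z)" for i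
  proof -
    have "D i holomorphic_on S" unfolding D_def by (rule holomorphic_higher_deriv) (use hol in auto)
    then show ?thesis
      using holomorphic_derivI[of "D i" S z] hol by (simp add: D_def)
  qed
  define t where "t i = (-1) ^ i * D i z * D (k - i) z" for i
  have "((\<lambda>z. \<Sum>i<k. (-1) ^ i * D i z * D (k - 1 - i) z) has_field_derivative
         (\<Sum>i<k. (-1) ^ i * D (Suc i) z * D (k - 1 - i) z
                  + D (Suc (k - 1 - i)) z * ((-1) ^ i * D i z))) (at z)"
    by (intro DERIV_sum DERIV_mult DERIV_cmult D)
  also have "(\<Sum>i<k. (-1) ^ i * D (Suc i) z * D (k - 1 - i) z
                  + D (Suc (k - 1 - i)) z * ((-1) ^ i * D i z)) = (\<Sum>i<k. t i - t (Suc i))"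
  proof (intro sum.cong refl)
    fix i assume "i \<in> {..<k}"
    then have "Suc (k - 1 - i) = k - i" "k - 1 - i = k - Suc i" by auto
    then show "(-1) ^ i * D (Suc i) z * D (k - 1 - i) z + D (Suc (k - 1 - i)) z * ((-1) ^ i * D i z)
        = t i - t (Suc i)" by (simp add: t_def algebra_simps)
  qed
  also have "\<dots> = t 0 - t k" by (rule sum_lessThan_telescope')
  also have "\<dots> = 2 * f z * (deriv ^^ k) f z" using k by (simp add: t_def D_def)
  finally show ?thesis unfolding concomitant_def[abs_def] D_def by simp
qed

text \<open>
  A primitive of a periodic function grows by a constant in each period.
\<close>

lemma concomitant_shift_const:
  assumes hol: "f holomorphic_on S" "open S" "connected S" and k: "odd k"
    and inv: "\<And>z. z \<in> S \<Longrightarrow> z + c \<in> S"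
    and per: "\<And>z. z \<in> S \<Longrightarrow> f (z + c) * (deriv ^^ k) f (z + c) = f z * (deriv ^^ k) f z"
  obtains A where "\<And>z n. z \<in> S \<Longrightarrow> concomitant k f (z + of_nat n * c) = concomitant k f z + of_nat n * A"
proof -
  have der: "((\<lambda>z. concomitant k f (z + c) - concomitant k f z) has_field_derivative 0) (at z)"
    if z: "z \<in> S" for z
  proof -
    have "((\<lambda>z. concomitant k f (z + c)) has_field_derivative
        2 * f (z + c) * (deriv ^^ k) f (z + c)) (at z)"
      using concomitant_has_field_derivative[OF hol(1,2) inv[OF z] k] by (simp flip: DERIV_shift)
    from DERIV_diff[OF this concomitant_has_field_derivative[OF hol(1,2) z k]] per[OF z]
    show ?thesis by (simp add: mult.assoc)
  qed
  obtain A where A: "\<And>z. z \<in> S \<Longrightarrow> concomitant k f (z + c) - concomitant k f z = A"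
    using has_field_derivative_0_imp_constant_on[OF der hol(3,2)] unfolding constant_on_def by blast
  have "z + of_nat n * c \<in> S \<and>
      concomitant k f (z + of_nat n * c) = concomitant k f z + of_nat n * A" if "z \<in> S" for z n
  proof (induction n)
    case (Suc n)
    then show ?case
      using inv[of "z + of_nat n * c"] A[of "z + of_nat n * c"] by (simp add: algebra_simps)
  qed (use that in simp)
  then show ?thesis using that by blast
qed

lemma concomitant_bounded:
  assumes hol: "f holomorphic_on S" "open S" "cball z \<epsilon> \<subseteq> S" "\<epsilon> > 0"
    and B: "\<And>w. w \<in> cball z \<epsilon> \<Longrightarrow> norm (f w) \<le> B"
  shows "norm (concomitant k f z)
    \<le> (\<Sum>i<k. (fact i * B / \<epsilon> ^ i) * (fact (k - 1 - i) * B / \<epsilon> ^ (k - 1 - i)))"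
proof -
  have d: "norm ((deriv ^^ i) f z) \<le> fact i * B / \<epsilon> ^ i" for i
  proof (rule Cauchy_inequality)
    show "f holomorphic_on ball z \<epsilon>" using hol by (meson ball_subset_cball holomorphic_on_subset)
    show "continuous_on (cball z \<epsilon>) f"
      using hol holomorphic_on_imp_continuous_on holomorphic_on_subset by blast
    show "norm (f x) \<le> B" if "norm (z - x) = \<epsilon>" for x
      using B[of x] that by (simp add: dist_norm)
  qed (use hol in auto)
  have "norm (concomitant k f z)
      \<le> (\<Sum>i<k. norm ((-1) ^ i * (deriv ^^ i) f z * (deriv ^^ (k - 1 - i)) f z))"
    unfolding concomitant_def by (rule norm_sum)
  also have "\<dots> \<le> (\<Sum>i<k. (fact i * B / \<epsilon> ^ i) * (fact (k - 1 - i) * B / \<epsilon> ^ (k - 1 - i)))"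
    unfolding norm_mult norm_power
    by (intro sum_mono mult_mono) (use d order_trans[OF norm_ge_zero d] in auto)
  finally show ?thesis .
qed

lemma has_laurent_expansion_higher_deriv:
  assumes "f has_laurent_expansion F"
  shows "(deriv ^^ i) f has_laurent_expansion (fls_deriv ^^ i) F"
  by (induction i) (use assms in \<open>auto intro: has_laurent_expansion_deriv\<close>)

lemma has_laurent_expansion_concomitant:
  assumes "f has_laurent_expansion F"
  shows "concomitant k f has_laurent_expansion fls_concomitant k F"
proof -
  have "(-1 :: complex fls) ^ i = fls_const ((-1) ^ i)" for i by (cases "even i") auto
  then show ?thesis
    unfolding concomitant_def[abs_def] fls_concomitant_def
    by (auto intro!: laurent_expansion_intros has_laurent_expansion_higher_deriv assms)
qed

section \<open>Functions with a pole\<close>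

lemma fls_higher_deriv_nonzero:
  fixes F :: "complex fls"
  assumes "fls_subdegree F < 0"
  shows "(fls_deriv ^^ k) F \<noteq> 0"
proof -
  have "F \<noteq> 0" using assms by auto
  moreover have "falling (fls_subdegree F) k \<noteq> 0"
    using falling_neg_sgn[of "- fls_subdegree F" k] assms by auto
  ultimately have "((fls_deriv ^^ k) F) $$ (fls_subdegree F - int k) \<noteq> 0"
    by (simp add: fls_nth_higher_deriv)
  then show ?thesis by auto
qed

lemma has_laurent_expansion_lead_tendsto:
  assumes F: "(\<lambda>w. f (z + w)) has_laurent_expansion F" and p: "fls_subdegree F = - int p"
  shows "((\<lambda>w. (w - z) ^ p * f w) \<longlongrightarrow> F $$ (- int p)) (at z)"
proof -
  have "(\<lambda>w. f (z + w) * w powi int p) has_laurent_expansion fls_shift (- int p) F"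
    by (rule has_laurent_expansion_shift[OF F])
  then have "(\<lambda>w. (w ^ p * f (z + w))) has_laurent_expansion fls_shift (- int p) F"
    by (simp add: mult.commute)
  then have *: "(\<lambda>w. ((z + w - z) ^ p * f (z + w))) has_laurent_expansion fls_shift (- int p) F"
    by simp
  moreover have "fls_subdegree (fls_shift (- int p) F) \<ge> 0"
  proof (cases "F = 0")
    case False then show ?thesis using p by simp
  qed simp
  ultimately show ?thesis
    using has_laurent_expansion_imp_tendsto[of "\<lambda>w. (w - z) ^ p * f w", OF *] by simp
qed

text \<open>
  All translates \<open>f (z + n c)\<close> have the same product with their \<open>k\<close>-th derivative, hence poles of
  the same order at \<open>z0\<close> and leading coefficients that agree up to sign, so two of any three
  translates share the leading coefficient. If these two were different, \<open>k\<close> would be odd and the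
  concomitant would not be periodic, so it would grow linearly along \<open>z + n c\<close>. But near \<open>z0\<close> the
  translates omit 0 (because \<open>f f\<^sup>(\<^sup>k\<^sup>)\<close> has no zeros there) and \<open>\<eta>\<close>, so they and their concomitants
  are uniformly bounded at some point.
\<close>

proposition periodic_if_pole:
  assumes nice: "f nicely_meromorphic_on UNIV"
    and \<eta>: "\<eta> \<noteq> 0" "picard_exceptional f \<eta>" and k: "k > 0" and c: "c \<noteq> 0"
    and per: "\<forall>\<^sub>\<approx>z\<in>UNIV. f (z + c) * (deriv ^^ k) f (z + c) = f z * (deriv ^^ k) f z"
    and pole: "is_pole f z0"
  shows "periodic_meromorphic f"
proof -
  define P where "P = {z. is_pole f z}"
  have mero: "f meromorphic_on UNIV" using nice by (simp add: nicely_meromorphic_on_def)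
  have P: "P sparse_in UNIV"
    using meromorphic_on_imp_not_pole_cosparse[OF mero] by (simp add: eventually_cosparse P_def)
  have opn: "open (- P)" using sparse_in_UNIV_imp_closed[OF P] by (rule open_Compl)
  have con: "connected (- P)"
    using sparse_imp_connected[OF _ connected_UNIV open_UNIV P] by (simp add: Compl_eq_Diff_UNIV)
  have ana: "f analytic_on {z}" if "z \<notin> P" for z
    using nicely_meromorphic_on_imp_analytic_at[OF nice, of z] that by (simp add: P_def)
  have "f analytic_on - P"
    unfolding analytic_on_analytic_at[of f "- P"] using ana by simp
  then have hol: "f holomorphic_on - P" by (rule analytic_imp_holomorphic)
  define D where "D = (deriv ^^ k) f"
  have holD: "D holomorphic_on - P"
    unfolding D_def by (rule holomorphic_higher_deriv[OF hol opn])
  define L where "L z = laurent_expansion f z" for z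
  have L: "(\<lambda>w. f (z + w)) has_laurent_expansion L z" for z
    unfolding L_def by (rule meromorphic_on_imp_has_laurent_expansion[OF mero]) simp
  have LD: "(\<lambda>w. (deriv ^^ i) f (z + w)) has_laurent_expansion (fls_deriv ^^ i) (L z)" for i z
    using has_laurent_expansion_higher_deriv[OF L[of z], of i]
      higher_deriv_shift[of i f z] by (simp add: add.commute)
  have LH: "(\<lambda>w. f (z + w) * D (z + w)) has_laurent_expansion L z * (fls_deriv ^^ k) (L z)" for z
    unfolding D_def by (intro laurent_expansion_intros L LD)
  have Leq1: "L (z + c) * (fls_deriv ^^ k) (L (z + c)) = L z * (fls_deriv ^^ k) (L z)" for z
  proof -
    have "eventually (\<lambda>w. f (w + c) * D (w + c) = f w * D w) (at z)"
      using eventually_cosparse_imp_eventually_at[OF per, of z UNIV] by (simp add: D_def)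
    then have ev: "eventually (\<lambda>w. f (z + c + w) * D (z + c + w) = f (z + w) * D (z + w)) (at 0)"
      by (simp add: eventually_at_to_0[of _ z] ac_simps)
    have "(\<lambda>w. f (z + w) * D (z + w)) has_laurent_expansion
        L (z + c) * (fls_deriv ^^ k) (L (z + c))"
      using LH[of "z + c"] has_laurent_expansion_cong[OF ev refl] by simp
    then show ?thesis by (rule has_laurent_expansion_unique[OF _ LH[of z]])
  qed
  have Leq: "L (z + of_nat n * c) * (fls_deriv ^^ k) (L (z + of_nat n * c))
      = L z * (fls_deriv ^^ k) (L z)" for z n
  proof (induction n)
    case (Suc n)
    have e: "z + of_nat n * c + c = z + of_nat (Suc n) * c" by (simp add: algebra_simps)
    show ?case using Leq1[of "z + of_nat n * c"] Suc unfolding e by simp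
  qed simp
  have P_iff: "z \<in> P \<longleftrightarrow> fls_subdegree (L z) < 0" for z
    using has_laurent_expansion_imp_is_pole_iff[OF L[of z]] by (simp add: P_def)
  have Pinv: "z + of_nat n * c \<in> P \<longleftrightarrow> z \<in> P" for z n
  proof
    assume "z \<in> P" then show "z + of_nat n * c \<in> P"
      using fls_pole_lead_square(1)[OF Leq[of z n]] by (simp add: P_iff)
  next
    assume "z + of_nat n * c \<in> P" then show "z \<in> P"
      using fls_pole_lead_square(1)[OF Leq[of z n, symmetric]] by (simp add: P_iff)
  qed
  have Pinv1: "z + c \<in> P \<longleftrightarrow> z \<in> P" for z using Pinv[of z 1] by simp
  have Hper1: "f (z + c) * D (z + c) = f z * D z" if z: "z \<in> - P" for z
  proof -
    have holH: "(\<lambda>z. f z * D z) holomorphic_on - P" by (intro holomorphic_intros hol holD)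
    have "((\<lambda>z. f z * D z) \<circ> (\<lambda>z. z + c)) holomorphic_on - P"
      by (rule holomorphic_on_compose_gen[OF _ holH]) (use Pinv1 in \<open>auto intro!: holomorphic_intros\<close>)
    from holomorphic_on_imp_continuous_on[OF this] holomorphic_on_imp_continuous_on[OF holH]
    have "isCont (\<lambda>z. f z * D z) z" "isCont (\<lambda>z. f (z + c) * D (z + c)) z"
      using z by (simp_all add: continuous_on_eq_continuous_at[OF opn] o_def)
    then have 1: "((\<lambda>w. f w * D w) \<longlongrightarrow> f z * D z) (at z)"
      and 2: "((\<lambda>w. f (w + c) * D (w + c)) \<longlongrightarrow> f (z + c) * D (z + c)) (at z)"
      by (simp_all add: isCont_def)
    have "eventually (\<lambda>w. f (w + c) * D (w + c) = f w * D w) (at z)"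
      using eventually_cosparse_imp_eventually_at[OF per, of z UNIV] by (simp add: D_def)
    with 1 have "((\<lambda>w. f (w + c) * D (w + c)) \<longlongrightarrow> f z * D z) (at z)"
      by (simp add: tendsto_cong)
    then show ?thesis by (rule tendsto_unique[OF at_neq_bot 2])
  qed
  have Hper: "f (z + of_nat n * c) * D (z + of_nat n * c) = f z * D z" if z: "z \<in> - P" for z n
  proof (induction n)
    case (Suc n)
    have e: "z + of_nat n * c + c = z + of_nat (Suc n) * c" by (simp add: algebra_simps)
    have "z + of_nat n * c \<in> - P" using Pinv z by simp
    from Hper1[OF this] Suc show ?case unfolding e by simp
  qed simp
  have neg: "fls_subdegree (L z0) < 0" using pole P_iff by (simp add: P_def)
  define p where "p = nat (- fls_subdegree (L z0))"
  have sub0: "fls_subdegree (L z0) = - int p" using neg by (simp add: p_def)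
  define F where "F n = L (z0 + of_nat n * c)" for n :: nat
  have F0: "F 0 = L z0" by (simp add: F_def)
  have Feq: "F n * (fls_deriv ^^ k) (F n) = F m * (fls_deriv ^^ k) (F m)" for m n
    unfolding F_def Leq ..
  have subF: "fls_subdegree (F n) = - int p" for n
    using fls_pole_lead_square(1)[OF Feq[of n 0]] neg sub0 by (simp add: F0)
  define a where "a n = F n $$ (- int p)" for n
  have asq: "(a n)\<^sup>2 = (a 0)\<^sup>2" for n
    using fls_pole_lead_square(2)[OF Feq[of n 0]] neg sub0 by (simp add: F0 a_def)
  have a0: "a n \<noteq> 0" for n
  proof -
    have "F n \<noteq> 0" using subF[of n] sub0 neg by auto
    then show ?thesis using nth_fls_subdegree_nonzero[of "F n"] by (simp add: a_def subF)
  qed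
  define g where "g n z = f (z + of_nat n * c)" for n z
  have gF: "(\<lambda>w. g n (z0 + w)) has_laurent_expansion F n" for n
    using L[of "z0 + of_nat n * c"] by (simp add: F_def g_def ac_simps)
  have holg: "g n holomorphic_on - P" for n
  proof -
    have "(f \<circ> (\<lambda>z. z + of_nat n * c)) holomorphic_on - P"
      by (rule holomorphic_on_compose_gen[OF _ hol]) (use Pinv in \<open>auto intro!: holomorphic_intros\<close>)
    then show ?thesis by (simp add: g_def[abs_def] o_def)
  qed
  \<comment> \<open>three numbers with the same square cannot be pairwise different\<close>
  obtain i j where ij: "i < j" "a i = a j"
  proof -
    have "a 0 = a 1 \<or> a 0 = a 2 \<or> a 1 = a 2"
      using asq[of 1] asq[of 2] by (auto simp: power2_eq_iff)
    then show ?thesis using that[of 0 1] that[of 0 2] that[of 1 2] by auto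
  qed
  have "F i = F j"
  proof (rule ccontr)
    assume "F i \<noteq> F j"
    have "odd k" and neq: "fls_concomitant k (F j) $$ 0 \<noteq> fls_concomitant k (F i) $$ 0"
      using fls_same_lead_imp_concomitant_neq[OF Feq[of j i] _ _ \<open>F i \<noteq> F j\<close> k] ij neg sub0
      by (simp_all add: subF a_def)
    have inv: "z + c \<in> - P" if "z \<in> - P" for z using Pinv1 that by simp
    obtain A where A: "\<And>z n. z \<in> - P \<Longrightarrow>
        concomitant k f (z + of_nat n * c) = concomitant k f z + of_nat n * A"
      using concomitant_shift_const[OF hol opn con \<open>odd k\<close> inv] Hper1 unfolding D_def by metis
    have Ag: "concomitant k (g n) z = concomitant k f z + of_nat n * A" if "z \<in> - P" for n z
      using A[OF that, of n] by (simp add: g_def[abs_def] concomitant_shift)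
    have punct: "eventually (\<lambda>z. z \<in> - P \<and> f z * D z \<noteq> 0) (at z0)"
    proof (rule eventually_conj)
      show "eventually (\<lambda>z. z \<in> - P) (at z0)"
        using meromorphic_on_imp_not_pole_cosparse[OF mero]
          eventually_cosparse_imp_eventually_at[of _ UNIV z0 UNIV] by (simp add: P_def)
      have "L z0 * (fls_deriv ^^ k) (L z0) \<noteq> 0"
        using neg fls_higher_deriv_nonzero[OF neg] by auto
      then show "eventually (\<lambda>z. f z * D z \<noteq> 0) (at z0)"
        using has_laurent_expansion_eventually_nonzero_iff[OF LH[of z0]] by blast
    qed
    have "A \<noteq> 0"
    proof
      assume "A = 0"
      have ev: "eventually (\<lambda>z. concomitant k (g j) z = concomitant k (g i) z) (at z0)"
        using punct by eventually_elim (simp add: Ag \<open>A = 0\<close>)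
      have con: "(\<lambda>w. concomitant k (g n) (z0 + w)) has_laurent_expansion fls_concomitant k (F n)" for n
      proof -
        have "concomitant k (\<lambda>w. g n (w + z0)) = (\<lambda>w. concomitant k (g n) (w + z0))"
          by (rule ext) (rule concomitant_shift)
        then show ?thesis
          using has_laurent_expansion_concomitant[OF gF[of n], of k] by (simp add: add.commute)
      qed
      have "(\<lambda>w. concomitant k (g i) (z0 + w)) has_laurent_expansion fls_concomitant k (F j)"
        using has_laurent_expansion_cong'[OF ev refl refl] con[of j] by simp
      then have "fls_concomitant k (F j) = fls_concomitant k (F i)"
        by (rule has_laurent_expansion_unique[OF _ con[of i]])
      then show False using neq by simp
    qed
    obtain \<rho> where \<rho>: "\<rho> > 0" "\<And>z. z \<in> ball z0 \<rho> - {z0} \<Longrightarrow> z \<in> - P \<and> f z * D z \<noteq> 0"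
      using punct unfolding eventually_at by (auto simp: dist_commute)
    have subP: "ball z0 \<rho> - {z0} \<subseteq> - P" using \<rho> by blast
    have C: "norm (a 0) > 0" using a0 by simp
    obtain z1 \<epsilon> B where \<epsilon>: "\<epsilon> > 0" and cb: "cball z1 \<epsilon> \<subseteq> ball z0 \<rho> - {z0}"
      and bd: "\<forall>h l. h holomorphic_on ball z0 \<rho> - {z0} \<and>
       (\<forall>z\<in>ball z0 \<rho> - {z0}. h z \<noteq> 0 \<and> h z \<noteq> \<eta>) \<and>
       ((\<lambda>z. (z - z0) ^ p * h z) \<longlongrightarrow> l) (at z0) \<and> l \<noteq> 0 \<and> norm l \<le> norm (a 0) \<longrightarrow>
       (\<forall>z\<in>cball z1 \<epsilon>. norm (h z) \<le> B)"
      by (rule punctured_disc_family_bounded[OF \<eta>(1) \<rho>(1) C, of z0 p])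
    have gB: "norm (g n z) \<le> B" if "z \<in> cball z1 \<epsilon>" for n z
    proof (rule bd[rule_format, OF _ that, of _ "a n"], intro conjI ballI)
      show "g n holomorphic_on ball z0 \<rho> - {z0}" by (rule holomorphic_on_subset[OF holg subP])
      show "((\<lambda>z. (z - z0) ^ p * g n z) \<longlongrightarrow> a n) (at z0)"
        unfolding a_def by (rule has_laurent_expansion_lead_tendsto[OF gF subF])
      show "a n \<noteq> 0" by (rule a0)
      show "norm (a n) \<le> norm (a 0)"
        using asq[of n] by (auto simp: power2_eq_iff)
    next
      fix z assume "z \<in> ball z0 \<rho> - {z0}"
      then have z: "z \<in> - P" "f z * D z \<noteq> 0" using \<rho> by auto
      show "g n z \<noteq> 0" using Hper[OF z(1), of n] z(2) by (auto simp: g_def)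
      show "g n z \<noteq> \<eta>"
        using \<eta>(2) Pinv[of z n] z(1) by (auto simp: g_def picard_exceptional_def P_def)
    qed
    have cb': "cball z1 \<epsilon> \<subseteq> - P" using cb subP by blast
    have "z1 \<in> cball z1 \<epsilon>" using \<epsilon> by simp
    with cb' have z1: "z1 \<in> - P" by blast
    obtain M where "\<And>n. norm (concomitant k (g n) z1) \<le> M"
      using concomitant_bounded[OF holg opn cb' \<epsilon> gB] by blast
    then have M: "norm (concomitant k f z1 + of_nat n * A) \<le> M" for n
      using Ag[OF z1] by metis
    have "real n * norm A \<le> M + norm (concomitant k f z1)" for n
      using M[of n] norm_triangle_ineq2[of "of_nat n * A" "- concomitant k f z1"]
      by (simp add: norm_mult add.commute)
    moreover have "norm A > 0" using \<open>A \<noteq> 0\<close> by simp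
    ultimately show False
      using reals_Archimedean3[of "norm A"] by (meson not_le)
  qed
  have ev: "eventually (\<lambda>z. g i z = g j z) (at z0)"
  proof -
    have "(\<lambda>w. g i (z0 + w) - g j (z0 + w)) has_laurent_expansion 0"
      using has_laurent_expansion_diff[OF gF[of i] gF[of j]] \<open>F i = F j\<close> by simp
    then have "eventually (\<lambda>w. g i (z0 + w) - g j (z0 + w) = 0) (at 0)"
      by (auto simp: has_laurent_expansion_def elim: eventually_mono)
    then show ?thesis by (simp add: eventually_at_to_0[of _ z0] add.commute)
  qed
  have gij: "g i z = g j z" if "z \<in> - P" for z
  proof -
    obtain \<rho> where \<rho>: "\<rho> > 0" "\<And>z. z \<in> ball z0 \<rho> - {z0} \<Longrightarrow> g i z = g j z"
      using ev unfolding eventually_at by (auto simp: dist_commute)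
    have ne: "(ball z0 \<rho> - {z0}) \<inter> - P \<noteq> {}"
    proof -
      have "eventually (\<lambda>z. z \<in> ball z0 \<rho> - {z0} \<and> z \<in> - P) (at z0)"
        using meromorphic_on_imp_not_pole_cosparse[OF mero]
          eventually_cosparse_imp_eventually_at[of _ UNIV z0 UNIV]
        by (intro eventually_conj eventually_at_in_open) (use \<rho> in \<open>auto simp: P_def\<close>)
      then show ?thesis using eventually_happens'[OF at_neq_bot] by blast
    qed
    show ?thesis
      by (rule analytic_continuation_open[OF _ opn ne con _ holg holg _ that])
        (use \<rho> opn in auto)
  qed
  define d where "d = of_nat (j - i) * c"
  have d: "d \<noteq> 0" using ij c by (simp add: d_def)
  have "f (z + d) = f z" if "z \<in> - P" for z
  proof -
    have "z - of_nat i * c \<in> - P" using Pinv[of "z - of_nat i * c" i] that by simp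
    from gij[OF this] show ?thesis
      using ij by (simp add: g_def d_def of_nat_diff algebra_simps)
  qed
  then have "\<forall>\<^sub>\<approx>z\<in>UNIV. f (z + d) = f z"
    using meromorphic_on_imp_not_pole_cosparse[OF mero] by (auto simp: P_def elim: eventually_mono)
  with d mero show ?thesis unfolding periodic_meromorphic_def by blast
qed

section \<open>Zero-free quotients and regular growth\<close>

text \<open>
  With \<open>h = g - g z0\<close>, rescaled to the unit disc, \<open>h / (2 A - h)\<close> maps the disc into itself and
  fixes 0, because \<open>Re h < A\<close> says that \<open>h\<close> is closer to 0 than to \<open>2 A\<close>. Schwarz's lemma applies.
\<close>

lemma Borel_Caratheodory:
  assumes hol: "g holomorphic_on ball z0 R" and A: "A > 0"
    and Re: "\<And>z. z \<in> ball z0 R \<Longrightarrow> Re (g z - g z0) < A"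
    and z: "z \<in> ball z0 R"
  shows "norm (g z - g z0) * (R - dist z0 z) \<le> 2 * A * dist z0 z"
proof -
  have R: "R > 0" using z by (metis ball_eq_empty empty_iff not_le)
  define E where "E w = z0 + of_real R * w" for w :: complex
  have E: "E w \<in> ball z0 R" if "norm w < 1" for w
    using that R by (simp add: E_def dist_norm norm_mult)
  define h where "h w = g (E w) - g z0" for w
  have "E holomorphic_on ball 0 1" unfolding E_def by (intro holomorphic_intros)
  moreover have "E ` ball 0 1 \<subseteq> ball z0 R" using E by auto
  ultimately have "(g \<circ> E) holomorphic_on ball 0 1"
    by (intro holomorphic_on_compose_gen[OF _ hol])
  then have holh: "h holomorphic_on ball 0 1"
    unfolding h_def o_def by (intro holomorphic_intros) auto
  have Reh: "Re (h w) < A" if "norm w < 1" for w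
    using Re[OF E[OF that]] by (simp add: h_def)
  have ne: "2 * of_real A - h w \<noteq> 0" if "norm w < 1" for w
  proof
    assume "2 * of_real A - h w = 0"
    then have "Re (2 * of_real A - h w) = 0" by simp
    then show False using Reh[OF that] A by simp
  qed
  have lt: "norm (h w) < norm (2 * of_real A - h w)" if "norm w < 1" for w
  proof -
    have "(norm (2 * of_real A - h w))\<^sup>2 - (norm (h w))\<^sup>2 = 4 * A * (A - Re (h w))"
      unfolding cmod_power2 by (simp add: power2_eq_square algebra_simps)
    also have "\<dots> > 0" using Reh[OF that] A by simp
    finally show ?thesis by (simp add: power2_less_imp_less)
  qed
  define v where "v = (z - z0) / of_real R"
  have nv: "norm v = dist z0 z / R"
    using R by (simp add: v_def norm_divide dist_norm norm_minus_commute)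
  have v1: "norm v < 1" using z R by (simp add: nv)
  have "norm (h v / (2 * of_real A - h v)) \<le> norm v"
  proof (rule Schwarz_Lemma(1)[of "\<lambda>w. h w / (2 * of_real A - h w)"])
    show "(\<lambda>w. h w / (2 * of_real A - h w)) holomorphic_on ball 0 1"
      using ne by (intro holomorphic_intros holh) auto
    show "norm (h w / (2 * of_real A - h w)) < 1" if "norm w < 1" for w
      using lt[OF that] ne[OF that] by (simp add: norm_divide)
  qed (use v1 in \<open>auto simp: h_def E_def\<close>)
  then have "norm (h v) \<le> norm v * norm (2 * of_real A - h v)"
    using ne[OF v1] by (simp add: norm_divide field_simps)
  also have "\<dots> \<le> norm v * (2 * A + norm (h v))"
    using norm_triangle_ineq4[of "2 * of_real A" "h v"] A
    by (intro mult_left_mono) (auto simp: norm_mult)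
  finally have le: "norm (h v) * (1 - norm v) \<le> 2 * A * norm v" by (simp add: algebra_simps)
  have hv: "h v = g z - g z0" using R by (simp add: h_def E_def v_def)
  have "norm (g z - g z0) * (R - dist z0 z) = R * (norm (h v) * (1 - norm v))"
    using R unfolding nv hv by (simp add: field_simps)
  also have "\<dots> \<le> R * (2 * A * norm v)" using le R by simp
  also have "\<dots> = 2 * A * dist z0 z" using R by (simp add: nv)
  finally show ?thesis .
qed

lemma entire_zero_factor:
  assumes hol: "D holomorphic_on UNIV" and "D w = 0" and "D z1 \<noteq> 0"
  obtains D1 n where "D1 holomorphic_on UNIV" "n > 0" "D1 w \<noteq> 0"
    "\<And>z. D z = (z - w) ^ n * D1 z"
proof -
  have "\<not> D constant_on UNIV" using assms(2,3) unfolding constant_on_def by (metis UNIV_I)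
  from holomorphic_factor_zero_nonconstant[OF hol open_UNIV connected_UNIV UNIV_I assms(2) this]
  obtain g r n where n: "0 < n" and r: "0 < r" and holg: "g holomorphic_on ball w r"
    and eq: "\<And>z. z \<in> ball w r \<Longrightarrow> D z = (z - w) ^ n * g z"
    and gn: "\<And>z. z \<in> ball w r \<Longrightarrow> g z \<noteq> 0" by metis
  define D1 where "D1 z = (if z = w then g w else D z / (z - w) ^ n)" for z
  have "D1 holomorphic_on ball w r"
    by (rule holomorphic_transform[OF holg]) (use eq in \<open>auto simp: D1_def\<close>)
  moreover have "(\<lambda>z. D z / (z - w) ^ n) holomorphic_on - {w}"
    by (intro holomorphic_intros holomorphic_on_subset[OF hol]) auto
  then have "D1 holomorphic_on - {w}"
    by (rule holomorphic_transform) (auto simp: D1_def)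
  ultimately have "D1 holomorphic_on (ball w r \<union> - {w})"
    by (intro holomorphic_on_Un) auto
  moreover have "ball w r \<union> - {w} = UNIV" using r by auto
  ultimately have "D1 holomorphic_on UNIV" by simp
  moreover have "D z = (z - w) ^ n * D1 z" for z
    using assms(2) n by (auto simp: D1_def)
  moreover have "D1 w \<noteq> 0" using gn[of w] r by (simp add: D1_def)
  ultimately show ?thesis using that n by blast
qed

text \<open>
  Each zero \<open>w\<close> in the disc is divided out and replaced by the factor that has the same modulus on
  the boundary circle and its zero at the point inverse to \<open>w\<close>, outside the disc. This is the inverse
  of a Blaschke factor, so it increases the modulus at the centre.
\<close>

lemma Blaschke_replacement:
  assumes "finite Z" and "D holomorphic_on UNIV" and "R > 0" and "D z1 \<noteq> 0"
    and "{z \<in> ball z0 R. D z = 0} = Z"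
  shows "\<exists>D'. D' holomorphic_on UNIV \<and> (\<forall>z\<in>ball z0 R. D' z \<noteq> 0) \<and>
           (\<forall>z\<in>sphere z0 R. norm (D' z) = norm (D z)) \<and> norm (D z0) \<le> norm (D' z0)"
  using assms
proof (induction Z arbitrary: D z1 rule: finite_induct)
  case empty
  then show ?case by (intro exI[of _ D]) auto
next
  case (insert w Z)
  have w: "w \<in> ball z0 R" "D w = 0" using insert.prems(4) by auto
  obtain D1 n where hol1: "D1 holomorphic_on UNIV" and n: "n > 0" and D1w: "D1 w \<noteq> 0"
    and eq: "\<And>z. D z = (z - w) ^ n * D1 z"
    using entire_zero_factor[OF insert.prems(1) w(2) insert.prems(3)] by metis
  have "{z \<in> ball z0 R. D1 z = 0} = Z"
  proof (intro set_eqI)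
    fix z
    have "z = w \<or> (D z = 0 \<longleftrightarrow> D1 z = 0)" using eq[of z] by auto
    moreover have "z \<in> insert w Z \<longleftrightarrow> z \<in> ball z0 R \<and> D z = 0" using insert.prems(4) by blast
    ultimately show "z \<in> {z \<in> ball z0 R. D1 z = 0} \<longleftrightarrow> z \<in> Z"
      using D1w insert.hyps(2) by auto
  qed
  from insert.IH[OF hol1 insert.prems(2) D1w this] obtain D1' where
    D1': "D1' holomorphic_on UNIV" "\<And>z. z \<in> ball z0 R \<Longrightarrow> D1' z \<noteq> 0"
      "\<And>z. z \<in> sphere z0 R \<Longrightarrow> norm (D1' z) = norm (D1 z)" "norm (D1 z0) \<le> norm (D1' z0)"
    by blast
  define \<phi> where "\<phi> z = (of_real (R\<^sup>2) - cnj (w - z0) * (z - z0)) / of_real R" for z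
  have R: "R > 0" by fact
  have wR: "norm (w - z0) < R" using w(1) by (simp add: dist_norm norm_minus_commute)
  have \<phi>0: "\<phi> z \<noteq> 0" if "z \<in> ball z0 R" for z
  proof -
    have "norm (z - z0) < R" using that by (simp add: dist_norm norm_minus_commute)
    then have "norm (cnj (w - z0) * (z - z0)) < R * R"
      using wR unfolding norm_mult complex_mod_cnj by (intro mult_strict_mono') auto
    then have "cnj (w - z0) * (z - z0) \<noteq> of_real (R\<^sup>2)"
      using R by (metis abs_of_pos norm_of_real power2_eq_square zero_less_power less_irrefl)
    then show ?thesis using R by (simp add: \<phi>_def)
  qed
  have \<phi>s: "norm (\<phi> z) = norm (z - w)" if "z \<in> sphere z0 R" for z
  proof -
    have nR: "norm (z - z0) = R" using that by (simp add: dist_norm norm_minus_commute)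
    have "of_real (R\<^sup>2) = (z - z0) * cnj (z - z0)"
      using nR by (metis complex_norm_square)
    then have "\<phi> z = (z - z0) * cnj (z - w) / of_real R"
      by (simp add: \<phi>_def algebra_simps)
    then show ?thesis using nR R by (simp add: norm_mult norm_divide flip: complex_cnj_diff)
  qed
  show ?case
  proof (intro exI[of _ "\<lambda>z. \<phi> z ^ n * D1' z"] conjI ballI)
    show "(\<lambda>z. \<phi> z ^ n * D1' z) holomorphic_on UNIV"
      unfolding \<phi>_def using R by (intro holomorphic_intros D1') auto
    show "\<phi> z ^ n * D1' z \<noteq> 0" if "z \<in> ball z0 R" for z
      using \<phi>0[OF that] D1'(2)[OF that] by simp
    show "norm (\<phi> z ^ n * D1' z) = norm (D z)" if "z \<in> sphere z0 R" for z
      using \<phi>s[OF that] D1'(3)[OF that] by (simp add: eq norm_mult norm_power)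
    have "norm (\<phi> z0) = R" using R by (simp add: \<phi>_def norm_divide power2_eq_square)
    moreover have "norm (z0 - w) ^ n \<le> R ^ n"
      using wR by (intro power_mono) (auto simp: norm_minus_commute)
    ultimately show "norm (D z0) \<le> norm (\<phi> z0 ^ n * D1' z0)"
      using D1'(4) R by (simp add: eq norm_mult norm_power mult_mono)
  qed
qed

text \<open>
  A quotient of two functions of modulus at most \<open>exp K\<close> that is zero-free, \<open>exp \<beta>\<close>, has a logarithm
  of size \<open>O(K)\<close> on smaller discs, although the denominator \<open>D\<close> may be small at some points. After
  replacing \<open>D\<close> by a zero-free \<open>exp g\<close> of the same modulus on the circle, both \<open>Re g\<close> and
  \<open>Re (g + \<beta>)\<close> are at most \<open>K\<close> in the disc by the maximum principle, and at the centre they are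
  bounded below in terms of \<open>D z0\<close>; the estimate for \<open>\<beta>\<close> is the difference of two
  Borel-Caratheodory estimates. This takes the place of Jensen's formula.
\<close>

lemma exp_quotient_bound:
  assumes hol: "\<beta> holomorphic_on UNIV" "D holomorphic_on UNIV" and D0: "D z0 \<noteq> 0"
    and bd: "\<And>z. z \<in> cball z0 R \<Longrightarrow> norm (D z) \<le> exp K"
      "\<And>z. z \<in> cball z0 R \<Longrightarrow> norm (D z * exp (\<beta> z)) \<le> exp K"
    and z: "z \<in> ball z0 R"
  shows "norm (\<beta> z - \<beta> z0) * (R - dist z0 z)
    \<le> 4 * dist z0 z * (K + 1 + \<bar>ln (norm (D z0))\<bar> + norm (\<beta> z0))"
proof -
  have R: "R > 0" using z by (metis ball_eq_empty empty_iff not_le)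
  have "finite {z \<in> ball z0 R. D z = 0}"
  proof (rule ccontr)
    assume inf: "infinite {z \<in> ball z0 R. D z = 0}"
    have "{z \<in> ball z0 R. D z = 0} \<subseteq> cball z0 R" by auto
    then obtain x where x: "x islimpt {z \<in> ball z0 R. D z = 0}"
      using compact_cball[of z0 R] inf unfolding compact_eq_Bolzano_Weierstrass by blast
    have "D z0 = 0"
      by (rule analytic_continuation[OF hol(2) open_UNIV connected_UNIV subset_UNIV UNIV_I x]) auto
    then show False using D0 by simp
  qed
  from Blaschke_replacement[OF this hol(2) R D0 refl] obtain D' where
    D': "D' holomorphic_on UNIV" "\<And>z. z \<in> ball z0 R \<Longrightarrow> D' z \<noteq> 0"
      "\<And>z. z \<in> sphere z0 R \<Longrightarrow> norm (D' z) = norm (D z)" "norm (D z0) \<le> norm (D' z0)"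
    by blast
  have z00: "z0 \<in> ball z0 R" using R by simp
  obtain g where g: "g holomorphic_on ball z0 R" "\<And>z. z \<in> ball z0 R \<Longrightarrow> exp (g z) = D' z"
    using holomorphic_logarithm_exists[OF convex_ball open_ball
        holomorphic_on_subset[OF D'(1) subset_UNIV] D'(2) z00] by blast
  have max: "norm (D' z * exp (h z)) \<le> exp K"
    if holh: "h holomorphic_on UNIV" and
      b: "\<And>z. z \<in> sphere z0 R \<Longrightarrow> norm (D z * exp (h z)) \<le> exp K" and z: "z \<in> ball z0 R" for h z
  proof (rule maximum_modulus_frontier[where S = "cball z0 R" and f = "\<lambda>z. D' z * exp (h z)"])
    have "(\<lambda>z. D' z * exp (h z)) holomorphic_on UNIV" by (intro holomorphic_intros D' holh)
    then show "(\<lambda>z. D' z * exp (h z)) holomorphic_on interior (cball z0 R)"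
      "continuous_on (closure (cball z0 R)) (\<lambda>z. D' z * exp (h z))"
      by (auto intro: holomorphic_on_subset holomorphic_on_imp_continuous_on)
    show "norm (D' w * exp (h w)) \<le> exp K" if "w \<in> frontier (cball z0 R)" for w
      using b[of w] D'(3)[of w] that by (simp add: norm_mult)
  qed (use z in auto)
  have Reg: "Re (g z) \<le> K" if z: "z \<in> ball z0 R" for z
  proof -
    have "norm (D' z * exp 0) \<le> exp K" by (rule max) (use bd(1) z in auto)
    then show ?thesis using g(2)[OF z, symmetric] by simp
  qed
  have Regb: "Re (g z + \<beta> z) \<le> K" if z: "z \<in> ball z0 R" for z
  proof -
    have "norm (D' z * exp (\<beta> z)) \<le> exp K" by (rule max[OF hol(1)]) (use bd(2) z in auto)
    then show ?thesis using g(2)[OF z, symmetric] by (simp add: norm_mult flip: exp_add)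
  qed
  have Re0: "Re (g z0) \<ge> - \<bar>ln (norm (D z0))\<bar>"
  proof -
    have "ln (norm (D z0)) \<le> ln (norm (D' z0))"
      using D'(4) D0 D'(2)[OF z00] by (subst ln_le_cancel_iff) auto
    also have "\<dots> = Re (g z0)" using g(2)[OF z00, symmetric] by simp
    finally show ?thesis by linarith
  qed
  define A where "A = K + 1 + \<bar>ln (norm (D z0))\<bar> + norm (\<beta> z0)"
  have Reb0: "- norm (\<beta> z0) \<le> Re (\<beta> z0)" using abs_Re_le_cmod[of "\<beta> z0"] by linarith
  have A: "A > 0" using Reg[OF z00] Re0 by (auto simp: A_def intro: add_pos_nonneg)
  have holb: "\<beta> holomorphic_on ball z0 R" using hol(1) holomorphic_on_subset by blast
  have 1: "norm (g z - g z0) * (R - dist z0 z) \<le> 2 * A * dist z0 z"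
  proof (rule Borel_Caratheodory[OF g(1) A _ z])
    show "Re (g z - g z0) < A" if "z \<in> ball z0 R" for z
      using Reg[OF that] Re0 norm_ge_zero[of "\<beta> z0"] unfolding A_def minus_complex.sel by linarith
  qed
  have 2: "norm ((g z + \<beta> z) - (g z0 + \<beta> z0)) * (R - dist z0 z) \<le> 2 * A * dist z0 z"
  proof (rule Borel_Caratheodory[OF _ A _ z])
    show "(\<lambda>z. g z + \<beta> z) holomorphic_on ball z0 R" by (intro holomorphic_intros g holb)
    show "Re ((g z + \<beta> z) - (g z0 + \<beta> z0)) < A" if "z \<in> ball z0 R" for z
      using Regb[OF that] Re0 Reb0 unfolding A_def minus_complex.sel plus_complex.sel by linarith
  qed
  have "norm (\<beta> z - \<beta> z0) \<le> norm ((g z + \<beta> z) - (g z0 + \<beta> z0)) + norm (g z - g z0)"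
    using norm_triangle_ineq4[of "(g z + \<beta> z) - (g z0 + \<beta> z0)" "g z - g z0"] by (simp add: algebra_simps)
  then have "norm (\<beta> z - \<beta> z0) * (R - dist z0 z)
      \<le> (norm ((g z + \<beta> z) - (g z0 + \<beta> z0)) + norm (g z - g z0)) * (R - dist z0 z)"
    using z by (intro mult_right_mono) auto
  also have "\<dots> \<le> 2 * A * dist z0 z + 2 * A * dist z0 z"
    using 1 2 by (simp add: distrib_right)
  finally show ?thesis by (simp add: A_def algebra_simps)
qed

text \<open>
  Borel's growth lemma. If \<open>Y\<close> more than doubled at every step \<open>r \<mapsto> r (1 + Y(r) powr (- 1/4))\<close>, the factors
  would be at most \<open>1 + q\<^sup>n\<close> with \<open>q = 2 powr (- 1/4) < 1\<close>, so the radii would stay bounded while \<open>Y\<close> tends to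
  infinity.
\<close>

lemma regular_growth_radius:
  fixes Y :: "real \<Rightarrow> real"
  assumes mono: "\<And>r s. 0 \<le> r \<Longrightarrow> r \<le> s \<Longrightarrow> Y r \<le> Y s"
    and unb: "\<And>N. \<exists>r\<ge>1. Y r \<ge> N"
  shows "\<exists>r\<ge>1. Y r \<ge> N \<and> Y (r * (1 + 1 / sqrt (sqrt (Y r)))) \<le> 2 * Y r"
proof (rule ccontr)
  assume "\<not> ?thesis"
  then have step: "Y (r * (1 + 1 / sqrt (sqrt (Y r)))) > 2 * Y r" if "r \<ge> 1" "Y r \<ge> N" for r
    using that by (meson not_le)
  obtain r0 where r0: "r0 \<ge> 1" "Y r0 \<ge> max 1 N" using unb by blast
  define s where "s n = ((\<lambda>r. r * (1 + 1 / sqrt (sqrt (Y r)))) ^^ n) r0" for n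
  define q where "q = 1 / sqrt (sqrt (2::real))"
  have q: "0 < q" "q < 1" by (auto simp: q_def)
  have s: "s n \<ge> 1 \<and> Y (s n) \<ge> N \<and> Y (s n) \<ge> 2 ^ n" for n
  proof (induction n)
    case 0 then show ?case using r0 by (simp add: s_def)
  next
    case (Suc n)
    have eq: "s (Suc n) = s n * (1 + 1 / sqrt (sqrt (Y (s n))))" by (simp add: s_def)
    have Y: "Y (s n) \<ge> 1" using Suc one_le_power[of "2::real" n] by linarith
    have "s n * 1 \<le> s n * (1 + 1 / sqrt (sqrt (Y (s n))))"
      using Suc Y by (intro mult_left_mono) auto
    then have "1 \<le> s (Suc n)" using Suc unfolding eq by linarith
    moreover have "Y (s (Suc n)) > 2 * Y (s n)" using step Suc by (simp add: eq)
    ultimately show ?case using Suc Y by auto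
  qed
  have "s n \<le> r0 * exp (\<Sum>i<n. q ^ i)" for n
  proof (induction n)
    case 0 then show ?case by (simp add: s_def)
  next
    case (Suc n)
    have Y: "Y (s n) \<ge> 2 ^ n" using s by blast
    then have "Y (s n) > 0" by (rule less_le_trans[rotated]) simp
    then have "1 / sqrt (sqrt (Y (s n))) \<le> 1 / sqrt (sqrt (2 ^ n))"
      using Y by (intro divide_left_mono) auto
    also have "\<dots> = q ^ n" by (simp add: q_def real_sqrt_power power_one_over)
    finally have "1 + 1 / sqrt (sqrt (Y (s n))) \<le> 1 + q ^ n" by simp
    also have "\<dots> \<le> exp (q ^ n)" by (rule exp_ge_add_one_self)
    finally have "s n * (1 + 1 / sqrt (sqrt (Y (s n)))) \<le> r0 * exp (\<Sum>i<n. q ^ i) * exp (q ^ n)"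
      using Suc s[of n] r0 \<open>Y (s n) > 0\<close>
      by (intro mult_mono) (auto intro: add_nonneg_nonneg)
    then show ?case by (simp add: s_def exp_add mult.assoc)
  qed
  moreover have "(\<Sum>i<n. q ^ i) \<le> 1 / (1 - q)" for n
    using q by (simp add: sum_gp_strict divide_right_mono)
  ultimately have le: "s n \<le> r0 * exp (1 / (1 - q))" for n
    using r0 by (meson exp_le_cancel_iff mult_left_mono order_trans zero_le_one)
  obtain n where n: "Y (r0 * exp (1 / (1 - q))) < 2 ^ n"
    using real_arch_pow[of 2 "Y (r0 * exp (1 / (1 - q)))"] by auto
  have "2 ^ n \<le> Y (s n)" using s by blast
  also have "\<dots> \<le> Y (r0 * exp (1 / (1 - q)))"
    by (rule mono) (use s[of n] le in auto)
  finally show False using n by simp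
qed

text \<open>
  At a radius of regular growth take \<open>\<delta>\<close> so that \<open>r + 2 \<delta>\<close> is the next radius of Borel's lemma. Then
  the bound reads \<open>y \<le> O(y powr (1/4) * ln y)\<close> for \<open>y = Y r\<close>, which fails for large \<open>y\<close>.
\<close>

lemma log_growth_contradiction:
  fixes Y :: "real \<Rightarrow> real"
  assumes mono: "\<And>r s. 0 \<le> r \<Longrightarrow> r \<le> s \<Longrightarrow> Y r \<le> Y s"
    and unb: "\<And>N. \<exists>r\<ge>1. Y r \<ge> N" and C: "C \<ge> 0"
    and bound: "\<And>r \<delta>. r \<ge> 1 \<Longrightarrow> \<delta> > 0 \<Longrightarrow>
      Y r \<le> C * (1 + r / \<delta>) * (1 + ln (Y (r + 2 * \<delta>) * (1 + 1 / \<delta>)))"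
  shows False
proof -
  have lim: "((\<lambda>y. (1 + 2 * sqrt (sqrt y)) * (1 + ln (2 * y * (1 + 2 * sqrt (sqrt y)))) / y) \<longlongrightarrow> 0) at_top"
    by real_asymp
  have "eventually (\<lambda>y. (1 + 2 * sqrt (sqrt y)) * (1 + ln (2 * y * (1 + 2 * sqrt (sqrt y)))) / y < 1 / (C + 1))
          at_top"
    by (rule order_tendstoD(2)[OF lim]) (use C in auto)
  then obtain N where N: "\<And>y. y \<ge> N \<Longrightarrow>
      (1 + 2 * sqrt (sqrt y)) * (1 + ln (2 * y * (1 + 2 * sqrt (sqrt y)))) / y < 1 / (C + 1)"
    by (auto simp: eventually_at_top_linorder)
  obtain r where r: "r \<ge> 1" "Y r \<ge> max 1 N" "Y (r * (1 + 1 / sqrt (sqrt (Y r)))) \<le> 2 * Y r"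
    using regular_growth_radius[of Y "max 1 N", OF mono unb] by blast
  define y where "y = Y r"
  define t where "t = sqrt (sqrt y)"
  have y: "y \<ge> 1" "y \<ge> N" using r by (auto simp: y_def)
  have t: "t \<ge> 1" using y by (simp add: t_def)
  define \<delta> where "\<delta> = r / (2 * t)"
  have \<delta>: "\<delta> > 0" "r / \<delta> = 2 * t" "r + 2 * \<delta> = r * (1 + 1 / t)"
    using r t by (auto simp: \<delta>_def field_simps)
  have d1: "1 / \<delta> \<le> 2 * t" using r t by (simp add: \<delta>_def field_simps)
  have "y \<le> Y (r + 2 * \<delta>)" unfolding y_def by (rule mono) (use r t \<delta> in auto)
  then have Y1: "Y (r + 2 * \<delta>) \<ge> 1" using y by linarith
  have "Y (r + 2 * \<delta>) * (1 + 1 / \<delta>) \<le> 2 * y * (1 + 2 * t)"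
  proof (rule mult_mono)
    show "Y (r + 2 * \<delta>) \<le> 2 * y" using r(3) unfolding \<delta>(3) by (simp add: y_def t_def)
  qed (use d1 y t \<delta>(1) in auto)
  moreover have "Y (r + 2 * \<delta>) * (1 + 1 / \<delta>) \<ge> 1"
    using Y1 \<delta> mult_mono[of 1 "Y (r + 2 * \<delta>)" 1 "1 + 1 / \<delta>"] by simp
  ultimately have ln: "ln (Y (r + 2 * \<delta>) * (1 + 1 / \<delta>)) \<le> ln (2 * y * (1 + 2 * t))"
    "ln (Y (r + 2 * \<delta>) * (1 + 1 / \<delta>)) \<ge> 0"
    by auto
  have "y \<le> C * (1 + 2 * t) * (1 + ln (Y (r + 2 * \<delta>) * (1 + 1 / \<delta>)))"
    using bound[OF r(1) \<delta>(1)] by (simp add: y_def \<delta>(2))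
  also have "\<dots> \<le> C * (1 + 2 * t) * (1 + ln (2 * y * (1 + 2 * t)))"
    using ln C t by (intro mult_left_mono) auto
  also have "\<dots> = C * ((1 + 2 * t) * (1 + ln (2 * y * (1 + 2 * t))))" by simp
  also have "\<dots> \<le> (C + 1) * ((1 + 2 * t) * (1 + ln (2 * y * (1 + 2 * t))))"
    using ln t by (intro mult_right_mono) auto
  also have "\<dots> < y"
    using N[OF y(2)] y C by (simp add: t_def field_simps)
  finally show False by simp
qed

section \<open>Differential polynomials and algebraic relations\<close>

text \<open>
  A substitute for the small functions of Nevanlinna theory. If \<open>Y r\<close> bounds \<open>\<beta>\<close> on the disc of
  radius \<open>r\<close>, then by Cauchy's estimates all differential polynomials in \<open>\<beta>\<close> are bounded by powers of
  \<open>Y\<close> at a slightly larger radius, while \<open>exp \<beta>\<close> may be exponentially large in \<open>Y\<close>. The loss of radius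
  \<open>\<delta>\<close> is left free, so that the class is closed under differentiation.
\<close>

definition small_wrt :: "(real \<Rightarrow> real) \<Rightarrow> complex \<Rightarrow> (complex \<Rightarrow> complex) \<Rightarrow> bool" where
  "small_wrt Y z0 a \<longleftrightarrow> a holomorphic_on UNIV \<and>
     (\<exists>C\<ge>0. \<exists>N::nat. \<forall>r\<ge>0. \<forall>\<delta>>0. \<forall>z\<in>cball z0 r. norm (a z) \<le> C * (Y (r + \<delta>) * (1 + 1 / \<delta>)) ^ N)"

lemma small_wrtE:
  assumes "small_wrt Y z0 a"
  obtains C N where "C \<ge> 0"
    "\<And>r \<delta> z. r \<ge> 0 \<Longrightarrow> \<delta> > 0 \<Longrightarrow> z \<in> cball z0 r \<Longrightarrow> norm (a z) \<le> C * (Y (r + \<delta>) * (1 + 1 / \<delta>)) ^ N"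
proof -
  from assms obtain C N where "C \<ge> 0"
    "\<forall>r\<ge>0. \<forall>\<delta>>0. \<forall>z\<in>cball z0 r. norm (a z) \<le> C * (Y (r + \<delta>) * (1 + 1 / \<delta>)) ^ N"
    unfolding small_wrt_def by blast
  then show ?thesis using that[of C N] by blast
qed

lemma small_wrtI:
  assumes "a holomorphic_on UNIV" "C \<ge> 0"
    "\<And>r \<delta> z. r \<ge> 0 \<Longrightarrow> \<delta> > 0 \<Longrightarrow> z \<in> cball z0 r \<Longrightarrow> norm (a z) \<le> C * (Y (r + \<delta>) * (1 + 1 / \<delta>)) ^ N"
  shows "small_wrt Y z0 a"
  unfolding small_wrt_def using assms by blast

lemma small_wrt_holomorphic: "small_wrt Y z0 a \<Longrightarrow> a holomorphic_on UNIV"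
  by (simp add: small_wrt_def)

context
  fixes Y :: "real \<Rightarrow> real" and z0 :: complex
  assumes Y1: "\<And>r. r \<ge> 0 \<Longrightarrow> Y r \<ge> 1"
    and Ymono: "\<And>r s. 0 \<le> r \<Longrightarrow> r \<le> s \<Longrightarrow> Y r \<le> Y s"
begin

lemma scale_ge_1: "r \<ge> 0 \<Longrightarrow> \<delta> > 0 \<Longrightarrow> Y (r + \<delta>) * (1 + 1 / \<delta>) \<ge> 1"
  using mult_mono[of 1 "Y (r + \<delta>)" 1 "1 + 1 / \<delta>"] Y1[of "r + \<delta>"] by simp

lemma small_wrt_const: "small_wrt Y z0 (\<lambda>_. c)"
  by (rule small_wrtI[where C = "norm c" and N = 0]) auto

lemma small_wrt_majorized:
  assumes "a holomorphic_on UNIV" "\<And>r z. r \<ge> 0 \<Longrightarrow> z \<in> cball z0 r \<Longrightarrow> norm (a z) \<le> Y r"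
  shows "small_wrt Y z0 a"
proof (rule small_wrtI[where C = 1 and N = 1])
  fix r \<delta> :: real and z assume *: "0 \<le> r" "0 < \<delta>" "z \<in> cball z0 r"
  have "norm (a z) \<le> Y (r + \<delta>) * 1"
    using assms(2)[OF *(1,3)] Ymono[of r "r + \<delta>"] * by simp
  also have "\<dots> \<le> Y (r + \<delta>) * (1 + 1 / \<delta>)"
    using Y1[of "r + \<delta>"] * by (intro mult_left_mono) auto
  finally show "norm (a z) \<le> 1 * (Y (r + \<delta>) * (1 + 1 / \<delta>)) ^ 1" by simp
qed (use assms in auto)

lemma small_wrt_mult:
  assumes "small_wrt Y z0 a" "small_wrt Y z0 b"
  shows "small_wrt Y z0 (\<lambda>z. a z * b z)"
proof -
  obtain C M where a: "C \<ge> 0" "\<And>r \<delta> z. r \<ge> 0 \<Longrightarrow> \<delta> > 0 \<Longrightarrow> z \<in> cball z0 r \<Longrightarrow>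
      norm (a z) \<le> C * (Y (r + \<delta>) * (1 + 1 / \<delta>)) ^ M"
    using small_wrtE[OF assms(1)] by metis
  obtain D N where b: "D \<ge> 0" "\<And>r \<delta> z. r \<ge> 0 \<Longrightarrow> \<delta> > 0 \<Longrightarrow> z \<in> cball z0 r \<Longrightarrow>
      norm (b z) \<le> D * (Y (r + \<delta>) * (1 + 1 / \<delta>)) ^ N"
    using small_wrtE[OF assms(2)] by metis
  show ?thesis
  proof (rule small_wrtI[where C = "C * D" and N = "M + N"])
    show "(\<lambda>z. a z * b z) holomorphic_on UNIV"
      using assms by (intro holomorphic_intros) (auto simp: small_wrt_holomorphic)
    fix r \<delta> :: real and z assume *: "0 \<le> r" "0 < \<delta>" "z \<in> cball z0 r"
    define X where "X = Y (r + \<delta>) * (1 + 1 / \<delta>)"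
    have "norm (a z * b z) \<le> (C * X ^ M) * (D * X ^ N)"
      unfolding norm_mult X_def
      by (rule mult_mono[OF a(2)[OF *] b(2)[OF *]])
        (use order_trans[OF norm_ge_zero a(2)[OF *]] in auto)
    then show "norm (a z * b z) \<le> C * D * X ^ (M + N)" by (simp add: power_add mult_ac)
  qed (use a b in auto)
qed

lemma small_wrt_add:
  assumes "small_wrt Y z0 a" "small_wrt Y z0 b"
  shows "small_wrt Y z0 (\<lambda>z. a z + b z)"
proof -
  obtain C M where a: "C \<ge> 0" "\<And>r \<delta> z. r \<ge> 0 \<Longrightarrow> \<delta> > 0 \<Longrightarrow> z \<in> cball z0 r \<Longrightarrow>
      norm (a z) \<le> C * (Y (r + \<delta>) * (1 + 1 / \<delta>)) ^ M"
    using small_wrtE[OF assms(1)] by metis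
  obtain D N where b: "D \<ge> 0" "\<And>r \<delta> z. r \<ge> 0 \<Longrightarrow> \<delta> > 0 \<Longrightarrow> z \<in> cball z0 r \<Longrightarrow>
      norm (b z) \<le> D * (Y (r + \<delta>) * (1 + 1 / \<delta>)) ^ N"
    using small_wrtE[OF assms(2)] by metis
  show ?thesis
  proof (rule small_wrtI[where C = "C + D" and N = "M + N"])
    show "(\<lambda>z. a z + b z) holomorphic_on UNIV"
      using assms by (intro holomorphic_intros) (auto simp: small_wrt_holomorphic)
    fix r \<delta> :: real and z assume *: "0 \<le> r" "0 < \<delta>" "z \<in> cball z0 r"
    define X where "X = Y (r + \<delta>) * (1 + 1 / \<delta>)"
    have X: "X \<ge> 1" unfolding X_def using * by (intro scale_ge_1)
    have "norm (a z + b z) \<le> C * X ^ M + D * X ^ N"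
      unfolding X_def by (rule order_trans[OF norm_triangle_ineq add_mono[OF a(2)[OF *] b(2)[OF *]]])
    also have "\<dots> \<le> C * X ^ (M + N) + D * X ^ (M + N)"
      using X a b by (intro add_mono mult_left_mono power_increasing) auto
    finally show "norm (a z + b z) \<le> (C + D) * X ^ (M + N)" by (simp add: algebra_simps)
  qed (use a b in auto)
qed

lemma small_wrt_uminus:
  assumes "small_wrt Y z0 a" shows "small_wrt Y z0 (\<lambda>z. - a z)"
  using small_wrt_mult[OF small_wrt_const[of "- 1"] assms] by simp

lemma small_wrt_diff:
  assumes "small_wrt Y z0 a" "small_wrt Y z0 b"
  shows "small_wrt Y z0 (\<lambda>z. a z - b z)"
  using small_wrt_add[OF assms(1) small_wrt_uminus[OF assms(2)]] by simp

lemma small_wrt_power: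
  assumes "small_wrt Y z0 a" shows "small_wrt Y z0 (\<lambda>z. a z ^ n)"
  by (induction n) (use small_wrt_mult[OF assms] small_wrt_const[of 1] in auto)

text \<open>
  Cauchy's estimate on a disc of radius \<open>\<delta> / 2\<close>; the other half of \<open>\<delta>\<close> is spent on the bound of \<open>a\<close>.
\<close>

lemma small_wrt_deriv:
  assumes "small_wrt Y z0 a" shows "small_wrt Y z0 (deriv a)"
proof -
  obtain C N where a: "C \<ge> 0" "\<And>r \<delta> z. r \<ge> 0 \<Longrightarrow> \<delta> > 0 \<Longrightarrow> z \<in> cball z0 r \<Longrightarrow>
      norm (a z) \<le> C * (Y (r + \<delta>) * (1 + 1 / \<delta>)) ^ N"
    using small_wrtE[OF assms] by metis
  have hol: "a holomorphic_on UNIV" using assms by (rule small_wrt_holomorphic)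
  show ?thesis
  proof (rule small_wrtI[where C = "C * 2 ^ Suc N" and N = "Suc N"])
    show "deriv a holomorphic_on UNIV" by (rule holomorphic_deriv[OF hol open_UNIV])
    fix r \<delta> :: real and z assume *: "0 \<le> r" "0 < \<delta>" "z \<in> cball z0 r"
    define X where "X = Y (r + \<delta>) * (1 + 1 / \<delta>)"
    have Y: "Y (r + \<delta>) \<ge> 1" using * by (intro Y1) auto
    have half: "Y (r + \<delta> / 2 + \<delta> / 2) * (1 + 1 / (\<delta> / 2)) \<le> 2 * X"
      using Y by (simp add: X_def algebra_simps)
    have "norm ((deriv ^^ 1) a z) \<le> fact 1 * (C * (2 * X) ^ N) / (\<delta> / 2) ^ 1"
    proof (rule Cauchy_inequality)
      show "a holomorphic_on ball z (\<delta> / 2)" using hol holomorphic_on_subset by blast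
      show "continuous_on (cball z (\<delta> / 2)) a"
        using hol holomorphic_on_imp_continuous_on holomorphic_on_subset by blast
      fix x assume x: "norm (z - x) = \<delta> / 2"
      have "x \<in> cball z0 (r + \<delta> / 2)"
        using dist_triangle[of z0 x z] x * by (simp add: dist_norm)
      then have "norm (a x) \<le> C * (Y (r + \<delta> / 2 + \<delta> / 2) * (1 + 1 / (\<delta> / 2))) ^ N"
        using * by (intro a) auto
      also have "\<dots> \<le> C * (2 * X) ^ N"
        using half a(1) scale_ge_1[of "r + \<delta> / 2" "\<delta> / 2"] *
        by (intro mult_left_mono power_mono) auto
      finally show "norm (a x) \<le> C * (2 * X) ^ N" .
    qed (use * in auto)
    then have "norm (deriv a z) \<le> C * (2 * X) ^ N * (2 * (1 / \<delta>))" by simp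
    also have "\<dots> \<le> C * (2 * X) ^ N * (2 * X)"
    proof (intro mult_left_mono)
      have "1 * (1 / \<delta>) \<le> X"
        unfolding X_def using Y * by (intro mult_mono) auto
      then show "1 / \<delta> \<le> X" by simp
      show "0 \<le> C * (2 * X) ^ N" using a(1) Y * by (simp add: X_def)
    qed auto
    finally show "norm (deriv a z) \<le> C * 2 ^ Suc N * X ^ Suc N" by (simp add: power_mult_distrib mult_ac)
  qed (use a in auto)
qed

lemma small_wrt_if:
  "small_wrt Y z0 a \<Longrightarrow> small_wrt Y z0 b \<Longrightarrow> small_wrt Y z0 (\<lambda>z. if c then a z else b z)"
  by (cases c) auto

lemmas small_wrt_intros = small_wrt_if small_wrt_const small_wrt_add small_wrt_diff small_wrt_mult
  small_wrt_uminus small_wrt_power small_wrt_deriv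

text \<open>
  If \<open>u = exp \<beta>\<close> satisfies a polynomial equation with small coefficients, then the leading coefficient
  times \<open>u\<close> is at most the sum of the moduli of all coefficients (trivially where \<open>|u| \<le> 1\<close>, by the
  equation where \<open>|u| \<ge> 1\<close>). So \<open>u\<close> is a zero-free quotient of two functions of size \<open>Y\<^sup>N\<close>, and \<open>\<beta>\<close>
  itself is only of size \<open>log Y\<close>.
\<close>

lemma algebraic_over_small_bound:
  assumes hol: "\<beta> holomorphic_on UNIV"
    and small: "\<And>i. i \<le> d \<Longrightarrow> small_wrt Y z0 (a i)"
    and alg: "\<And>z. (\<Sum>i\<le>d. a i z * exp (\<beta> z) ^ i) = 0"
    and d: "d \<ge> 1" and ad: "a d z0 \<noteq> 0"
  shows "\<exists>C\<ge>0. \<forall>r\<ge>1. \<forall>\<delta>>0. \<forall>z\<in>cball z0 r.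
    norm (\<beta> z) \<le> C * (1 + r / \<delta>) * (1 + ln (Y (r + 2 * \<delta>) * (1 + 1 / \<delta>)))"
proof -
  have "\<exists>C\<ge>0. \<exists>N::nat. \<forall>r\<ge>0. \<forall>\<delta>>0. \<forall>z\<in>cball z0 r.
      (\<Sum>i\<le>e. norm (a i z)) \<le> C * (Y (r + \<delta>) * (1 + 1 / \<delta>)) ^ N" if "e \<le> d" for e
    using that
  proof (induction e)
    case 0
    then show ?case using small[of 0] unfolding small_wrt_def by simp
  next
    case (Suc e)
    from Suc obtain C N where C: "C \<ge> 0" and CN: "\<And>r \<delta> z. r \<ge> 0 \<Longrightarrow> \<delta> > 0 \<Longrightarrow> z \<in> cball z0 r \<Longrightarrow>
        (\<Sum>i\<le>e. norm (a i z)) \<le> C * (Y (r + \<delta>) * (1 + 1 / \<delta>)) ^ N" by (meson Suc_leD)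
    obtain D M where D: "D \<ge> 0" and DM: "\<And>r \<delta> z. r \<ge> 0 \<Longrightarrow> \<delta> > 0 \<Longrightarrow> z \<in> cball z0 r \<Longrightarrow>
        norm (a (Suc e) z) \<le> D * (Y (r + \<delta>) * (1 + 1 / \<delta>)) ^ M"
      using small_wrtE[OF small[OF Suc.prems]] by metis
    show ?case
    proof (intro exI[of _ "C + D"] exI[of _ "N + M"] conjI allI impI ballI)
      fix r \<delta> z assume *: "0 \<le> (r::real)" "0 < (\<delta>::real)" "z \<in> cball z0 r"
      define X where "X = Y (r + \<delta>) * (1 + 1 / \<delta>)"
      have X: "X \<ge> 1" unfolding X_def using * by (intro scale_ge_1)
      have "(\<Sum>i\<le>Suc e. norm (a i z)) \<le> C * X ^ N + D * X ^ M"
        using CN[OF *] DM[OF *] by (simp add: X_def)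
      also have "\<dots> \<le> C * X ^ (N + M) + D * X ^ (N + M)"
        using X C D by (intro add_mono mult_left_mono power_increasing) auto
      finally show "(\<Sum>i\<le>Suc e. norm (a i z)) \<le> (C + D) * X ^ (N + M)" by (simp add: algebra_simps)
    qed (use C D in auto)
  qed
  from this[OF order_refl] obtain C N where C: "C \<ge> 0"
    and CN: "\<And>r \<delta> z. r \<ge> 0 \<Longrightarrow> \<delta> > 0 \<Longrightarrow> z \<in> cball z0 r \<Longrightarrow>
      (\<Sum>i\<le>d. norm (a i z)) \<le> C * (Y (r + \<delta>) * (1 + 1 / \<delta>)) ^ N" by metis
  have sum_ge: "norm (a d z) \<le> (\<Sum>i\<le>d. norm (a i z))" for z
    by (rule member_le_sum) auto
  have le: "norm (a d z * exp (\<beta> z)) \<le> (\<Sum>i\<le>d. norm (a i z))" for z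
  proof (cases "norm (exp (\<beta> z)) \<le> 1")
    case True
    then have "norm (a d z * exp (\<beta> z)) \<le> norm (a d z) * 1"
      unfolding norm_mult by (intro mult_left_mono) auto
    then show ?thesis using sum_ge[of z] by linarith
  next
    case False
    define u where "u = exp (\<beta> z)"
    have u: "norm u \<ge> 1" using False by (simp add: u_def)
    obtain e where e: "d = Suc e" using d by (cases d) auto
    have "a d z * u ^ d = - (\<Sum>i\<le>e. a i z * u ^ i)"
      using alg[of z] by (simp add: e u_def eq_neg_iff_add_eq_0 add.commute)
    then have "norm (a d z * u ^ d) = norm (\<Sum>i\<le>e. a i z * u ^ i)"
      by (metis norm_minus_cancel)
    then have "norm (a d z * u) * norm u ^ e = norm (\<Sum>i\<le>e. a i z * u ^ i)"
      by (simp only: e norm_mult norm_power power_Suc mult.assoc)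
    also have "\<dots> \<le> (\<Sum>i\<le>e. norm (a i z) * norm u ^ e)"
    proof (rule sum_norm_le)
      fix i assume "i \<in> {..e}"
      then show "norm (a i z * u ^ i) \<le> norm (a i z) * norm u ^ e"
        unfolding norm_mult norm_power using u by (intro mult_left_mono power_increasing) auto
    qed
    also have "\<dots> = (\<Sum>i\<le>e. norm (a i z)) * norm u ^ e" by (simp add: sum_distrib_right)
    finally have "norm (a d z * u) \<le> (\<Sum>i\<le>e. norm (a i z))"
    proof (rule mult_right_le_imp_le)
      show "0 < norm u ^ e" using u by (intro zero_less_power) linarith
    qed
    then show ?thesis by (simp add: e u_def add_increasing2)
  qed
  define c where "c = 1 + \<bar>ln (norm (a d z0))\<bar> + norm (\<beta> z0) + ln (C + 1)"
  have lnC: "ln (C + 1) \<ge> 0" using C by simp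
  have c: "c \<ge> 1" using lnC by (simp add: c_def)
  have hold: "a d holomorphic_on UNIV" using small_wrt_holomorphic[OF small[OF order_refl]] .
  show ?thesis
  proof (intro exI[of _ "4 * c * (1 + real N)"] conjI allI impI ballI)
    fix r \<delta> z assume *: "1 \<le> (r::real)" "0 < (\<delta>::real)" "z \<in> cball z0 r"
    define X where "X = Y (r + 2 * \<delta>) * (1 + 1 / \<delta>)"
    have r2: "r + \<delta> + \<delta> = r + 2 * \<delta>" by simp
    have X: "X \<ge> 1"
      using scale_ge_1[of "r + \<delta>" \<delta>] * unfolding r2 X_def by simp
    have lnX: "ln X \<ge> 0" using X by simp
    define K where "K = ln (C + 1) + real N * ln X"
    have expK: "exp K = (C + 1) * X ^ N"
      using C X by (simp add: K_def exp_add exp_of_nat_mult)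
    have bd: "(\<Sum>i\<le>d. norm (a i w)) \<le> exp K" if "w \<in> cball z0 (r + \<delta>)" for w
    proof -
      have "(\<Sum>i\<le>d. norm (a i w)) \<le> C * (Y (r + \<delta> + \<delta>) * (1 + 1 / \<delta>)) ^ N"
        using that * by (intro CN) auto
      also have "\<dots> = C * X ^ N" unfolding r2 X_def ..
      also have "\<dots> \<le> (C + 1) * X ^ N" using X by (intro mult_right_mono) auto
      finally show ?thesis by (simp add: expK)
    qed
    have dz: "dist z0 z \<le> r" using * by simp
    have "norm (\<beta> z - \<beta> z0) * (r + \<delta> - dist z0 z)
      \<le> 4 * dist z0 z * (K + 1 + \<bar>ln (norm (a d z0))\<bar> + norm (\<beta> z0))"
    proof (rule exp_quotient_bound[OF hol hold ad])
      show "norm (a d w) \<le> exp K" if "w \<in> cball z0 (r + \<delta>)" for w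
        using sum_ge[of w] bd[OF that] by linarith
      show "norm (a d w * exp (\<beta> w)) \<le> exp K" if "w \<in> cball z0 (r + \<delta>)" for w
        using le[of w] bd[OF that] by linarith
    qed (use * in auto)
    also have "K + 1 + \<bar>ln (norm (a d z0))\<bar> + norm (\<beta> z0) = c + real N * ln X"
      by (simp add: K_def c_def)
    finally have "norm (\<beta> z - \<beta> z0) * (r + \<delta> - dist z0 z) \<le> 4 * dist z0 z * (c + real N * ln X)" .
    moreover have "norm (\<beta> z - \<beta> z0) * \<delta> \<le> norm (\<beta> z - \<beta> z0) * (r + \<delta> - dist z0 z)"
      using dz by (intro mult_left_mono) auto
    moreover have "4 * dist z0 z * (c + real N * ln X) \<le> 4 * r * (c + real N * ln X)"
      using dz c lnX by (intro mult_right_mono) auto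
    ultimately have "norm (\<beta> z - \<beta> z0) * \<delta> \<le> 4 * r * (c + real N * ln X)" by linarith
    then have "norm (\<beta> z - \<beta> z0) \<le> 4 * (r / \<delta>) * (c + real N * ln X)"
      using * by (simp add: field_simps)
    then have "norm (\<beta> z) \<le> 4 * (r / \<delta>) * (c + real N * ln X) + norm (\<beta> z0)"
      using norm_triangle_sub[of "\<beta> z" "\<beta> z0"] by linarith
    also have "\<dots> \<le> 4 * (r / \<delta>) * (c + real N * ln X) + 4 * (c + real N * ln X)"
    proof -
      have "norm (\<beta> z0) \<le> c" using lnC by (simp add: c_def)
      also have "\<dots> \<le> 4 * (c + real N * ln X)" using c lnX by (simp add: add_increasing2)
      finally show ?thesis by simp
    qed
    also have "\<dots> = 4 * (1 + r / \<delta>) * (c + real N * ln X)" by (simp add: algebra_simps)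
    also have "\<dots> \<le> 4 * (1 + r / \<delta>) * (c * (1 + real N) * (1 + ln X))"
    proof (intro mult_left_mono)
      have "real N * ln X \<le> c * (real N * ln X)"
        using c lnX mult_right_mono[of 1 c "real N * ln X"] by simp
      then have "c + real N * ln X \<le> c + c * (real N * ln X)" by simp
      also have "\<dots> \<le> c + c * (real N * ln X) + (c * ln X + c * real N)" using c lnX by simp
      finally show "c + real N * ln X \<le> c * (1 + real N) * (1 + ln X)" by (simp add: algebra_simps)
    qed (use * in auto)
    also have "\<dots> = 4 * c * (1 + real N) * (1 + r / \<delta>) * (1 + ln X)"
      by (simp only: mult_ac)
    finally show "norm (\<beta> z) \<le> 4 * c * (1 + real N) * (1 + r / \<delta>) * (1 + ln X)" .
  qed (use c in auto)
qed

end

lemma entire_common_nonzero: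
  assumes "h1 holomorphic_on UNIV" "h2 holomorphic_on UNIV" "h1 z1 \<noteq> 0" "h2 z2 \<noteq> (0::complex)"
  obtains z where "h1 z \<noteq> 0" "h2 z \<noteq> 0"
proof -
  have "\<exists>z. h1 z \<noteq> 0 \<and> h2 z \<noteq> 0"
  proof (rule ccontr)
    assume *: "\<not> ?thesis"
    have "open {z. h1 z \<noteq> 0}"
      using holomorphic_on_imp_continuous_on[OF assms(1)] by (intro open_Collect_neq) auto
    then have "h2 z2 = 0"
      by (rule analytic_continuation_open[of _ UNIV h2 "\<lambda>_. 0"]) (use assms * in auto)
    then show False using assms by simp
  qed
  then show ?thesis using that by blast
qed

lemma entire_mult_eq_0:
  assumes "h1 holomorphic_on UNIV" "h2 holomorphic_on UNIV" "\<And>z. h1 z * h2 z = (0::complex)"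
  shows "(\<forall>z. h1 z = 0) \<or> (\<forall>z. h2 z = 0)"
  using entire_common_nonzero[OF assms(1,2)] assms(3) by (metis mult_eq_0_iff)

text \<open>
  With \<open>u = exp \<beta>\<close> and \<open>v = exp \<gamma>\<close>, combine \<open>P u (u + \<eta>) = R v (v + \<eta>)\<close> with its derivative so that
  \<open>v\<^sup>2\<close> cancels. The result is linear in \<open>v\<close>, namely \<open>\<kappa> v = - u (a u + \<eta> b)\<close>. Substituting this back
  into the relation leaves a cubic equation for \<open>u\<close> whose coefficients are differential polynomials;
  these are its coefficients, in ascending order.
\<close>

definition elim_coeff ::
  "complex \<Rightarrow> (complex \<Rightarrow> complex) \<Rightarrow> (complex \<Rightarrow> complex) \<Rightarrow> (complex \<Rightarrow> complex) \<Rightarrow> (complex \<Rightarrow> complex)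
    \<Rightarrow> nat \<Rightarrow> complex \<Rightarrow> complex" where
  "elim_coeff \<eta> \<beta> \<gamma> P R i z =
    (let \<kappa> = \<eta> * R z ^ 2 * deriv \<gamma> z;
         l = R z * deriv P z - deriv R z * P z - 2 * R z * P z * deriv \<gamma> z;
         a = l + 2 * R z * P z * deriv \<beta> z;
         b = l + R z * P z * deriv \<beta> z
     in if i = 0 then - (R z * \<eta>\<^sup>2 * b * \<kappa>) - \<kappa>\<^sup>2 * P z * \<eta>
        else if i = 1 then R z * (\<eta>\<^sup>2 * b\<^sup>2 - a * \<kappa> * \<eta>) - \<kappa>\<^sup>2 * P z
        else if i = 2 then 2 * R z * a * \<eta> * b
        else R z * a\<^sup>2)"

lemma elimination:
  assumes hol: "\<beta> holomorphic_on UNIV" "\<gamma> holomorphic_on UNIV" "P holomorphic_on UNIV" "R holomorphic_on UNIV"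
    and rel: "\<And>z. P z * exp (\<beta> z) * (exp (\<beta> z) + \<eta>) = R z * exp (\<gamma> z) * (exp (\<gamma> z) + \<eta>)"
  shows "(\<Sum>i\<le>3. elim_coeff \<eta> \<beta> \<gamma> P R i z * exp (\<beta> z) ^ i) = 0"
proof -
  define u v where "u = exp (\<beta> z)" and "v = exp (\<gamma> z)"
  have D: "(h has_field_derivative deriv h z) (at z)" if "h holomorphic_on UNIV" for h
    using holomorphic_derivI[OF that open_UNIV UNIV_I] .
  have "((\<lambda>z. P z * exp (\<beta> z) * (exp (\<beta> z) + \<eta>)) has_field_derivative
      deriv P z * u * (u + \<eta>) + P z * deriv \<beta> z * u * (2 * u + \<eta>)) (at z)"
    using hol by (auto intro!: derivative_eq_intros D simp: u_def algebra_simps)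
  moreover have "((\<lambda>z. R z * exp (\<gamma> z) * (exp (\<gamma> z) + \<eta>)) has_field_derivative
      deriv R z * v * (v + \<eta>) + R z * deriv \<gamma> z * v * (2 * v + \<eta>)) (at z)"
    using hol by (auto intro!: derivative_eq_intros D simp: v_def algebra_simps)
  ultimately have e2: "deriv P z * u * (u + \<eta>) + P z * deriv \<beta> z * u * (2 * u + \<eta>)
      = deriv R z * v * (v + \<eta>) + R z * deriv \<gamma> z * v * (2 * v + \<eta>)"
    unfolding rel by (rule DERIV_unique)
  have e1: "P z * u * (u + \<eta>) = R z * v * (v + \<eta>)" using rel[of z] by (simp add: u_def v_def)
  define p p' r r' s t where "p = P z" "p' = deriv P z" "r = R z" "r' = deriv R z" "s = deriv \<beta> z" "t = deriv \<gamma> z"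
  define \<kappa> l a b where "\<kappa> = \<eta> * r ^ 2 * t" "l = r * p' - r' * p - 2 * r * p * t"
    "a = l + 2 * r * p * s" "b = l + r * p * s"
  note defs = p_p'_r_r'_s_t_def \<kappa>_l_a_b_def
  have kv: "\<kappa> * v = - u * (a * u + \<eta> * b)"
    using e1 e2 unfolding defs by algebra
  have "u * (\<kappa>\<^sup>2 * p * (u + \<eta>)) = r * (\<kappa> * v) * (\<kappa> * v + \<kappa> * \<eta>)"
    using e1 unfolding defs by algebra
  also have "\<dots> = u * (r * (a * u + \<eta> * b) * (u * (a * u + \<eta> * b) - \<kappa> * \<eta>))"
    unfolding kv by (simp add: algebra_simps)
  finally have "\<kappa>\<^sup>2 * p * (u + \<eta>) = r * (a * u + \<eta> * b) * (u * (a * u + \<eta> * b) - \<kappa> * \<eta>)"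
    by (simp add: u_def)
  then have "(r * a\<^sup>2) * u ^ 3 + (2 * r * a * \<eta> * b) * u\<^sup>2
      + (r * (\<eta>\<^sup>2 * b\<^sup>2 - a * \<kappa> * \<eta>) - \<kappa>\<^sup>2 * p) * u + (- (r * \<eta>\<^sup>2 * b * \<kappa>) - \<kappa>\<^sup>2 * p * \<eta>) = 0"
    by algebra
  moreover have "elim_coeff \<eta> \<beta> \<gamma> P R 3 z = r * a\<^sup>2"
    "elim_coeff \<eta> \<beta> \<gamma> P R 2 z = 2 * r * a * \<eta> * b"
    "elim_coeff \<eta> \<beta> \<gamma> P R 1 z = r * (\<eta>\<^sup>2 * b\<^sup>2 - a * \<kappa> * \<eta>) - \<kappa>\<^sup>2 * p"
    "elim_coeff \<eta> \<beta> \<gamma> P R 0 z = - (r * \<eta>\<^sup>2 * b * \<kappa>) - \<kappa>\<^sup>2 * p * \<eta>"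
    by (simp_all add: elim_coeff_def Let_def defs)
  moreover have "(\<Sum>i\<le>3. X i * u ^ i) = X 3 * u ^ 3 + X 2 * u\<^sup>2 + X 1 * u + X 0" for X :: "nat \<Rightarrow> complex"
    by (simp add: eval_nat_numeral)
  ultimately show ?thesis by (simp add: u_def)
qed

text \<open>
  The leading coefficient gives \<open>a = 0\<close>, and then the two lowest ones give \<open>P = R\<close> and
  \<open>\<kappa> = - \<eta> b\<close>, hence \<open>\<beta>' = \<gamma>'\<close>.
\<close>

lemma elim_coeffs_zero:
  assumes \<eta>: "\<eta> \<noteq> 0" and nz: "P z \<noteq> 0" "R z \<noteq> 0" "deriv \<beta> z \<noteq> 0" "deriv \<gamma> z \<noteq> 0"
    and zero: "\<And>i. i \<le> 3 \<Longrightarrow> elim_coeff \<eta> \<beta> \<gamma> P R i z = 0"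
  shows "deriv \<beta> z = deriv \<gamma> z \<and> P z = R z"
proof -
  define p p' r r' s t where "p = P z" "p' = deriv P z" "r = R z" "r' = deriv R z" "s = deriv \<beta> z" "t = deriv \<gamma> z"
  define \<kappa> l a b where "\<kappa> = \<eta> * r ^ 2 * t" "l = r * p' - r' * p - 2 * r * p * t"
    "a = l + 2 * r * p * s" "b = l + r * p * s"
  note defs = p_p'_r_r'_s_t_def \<kappa>_l_a_b_def
  have c3: "r * a\<^sup>2 = 0" using zero[of 3] by (simp add: elim_coeff_def Let_def defs)
  have c1: "r * (\<eta>\<^sup>2 * b\<^sup>2 - a * \<kappa> * \<eta>) - \<kappa>\<^sup>2 * p = 0"
    using zero[of 1] by (simp add: elim_coeff_def Let_def defs)
  have c0: "- (r * \<eta>\<^sup>2 * b * \<kappa>) - \<kappa>\<^sup>2 * p * \<eta> = 0"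
    using zero[of 0] by (simp add: elim_coeff_def Let_def defs)
  have nz': "p \<noteq> 0" "r \<noteq> 0" "s \<noteq> 0" "t \<noteq> 0" using nz by (simp_all add: p_p'_r_r'_s_t_def)
  have \<kappa>: "\<kappa> \<noteq> 0" using \<eta> nz' by (simp add: \<kappa>_l_a_b_def)
  have a: "a = 0" using c3 nz' by simp
  have 1: "r * \<eta>\<^sup>2 * b\<^sup>2 = \<kappa>\<^sup>2 * p" using c1 a by (simp add: algebra_simps)
  have "\<kappa> * \<eta> * (r * \<eta> * b + \<kappa> * p) = 0" using c0 by algebra
  then have 2: "\<kappa> * p = - (r * \<eta> * b)" using \<kappa> \<eta> by (simp add: add_eq_0_iff2)
  have b: "b \<noteq> 0" using 2 \<kappa> nz' by auto
  have "r * \<eta> * b * (\<eta> * b + \<kappa>) = 0" using 1 2 by algebra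
  then have 3: "\<kappa> = - (\<eta> * b)" using nz' \<eta> b by (simp add: add_eq_0_iff2 add.commute)
  have "\<kappa> * (p - r) = 0" using 2 3 by algebra
  then have pr: "p = r" using \<kappa> by simp
  have "a - b = r * p * s" by (simp add: \<kappa>_l_a_b_def)
  then have "\<eta> * (r * p * s) = \<eta> * (a - b)" by simp
  then have "\<eta> * (r * p * s) = \<kappa>" unfolding 3 a by simp
  then have "\<eta> * r ^ 2 * (s - t) = 0"
    unfolding \<kappa>_l_a_b_def(1) pr by algebra
  then have "s = t" using \<eta> nz' by simp
  with pr show ?thesis by (simp add: p_p'_r_r'_s_t_def)
qed

section \<open>Entire functions omitting a value\<close>

lemma elim_coeff_small:
  assumes "\<And>r. r \<ge> 0 \<Longrightarrow> Y r \<ge> 1" "\<And>r s. 0 \<le> r \<Longrightarrow> r \<le> s \<Longrightarrow> Y r \<le> Y s"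
    and "small_wrt Y z0 \<beta>" "small_wrt Y z0 \<gamma>" "small_wrt Y z0 P" "small_wrt Y z0 R"
  shows "small_wrt Y z0 (elim_coeff \<eta> \<beta> \<gamma> P R i)"
proof -
  note intros = small_wrt_intros[OF assms(1,2)] assms(3-6)
  have "small_wrt Y z0 (\<lambda>z. elim_coeff \<eta> \<beta> \<gamma> P R i z)"
    unfolding elim_coeff_def Let_def
    by (intro intros)
  then show ?thesis by simp
qed

lemma elim_coeff_holomorphic:
  assumes "\<beta> holomorphic_on UNIV" "\<gamma> holomorphic_on UNIV" "P holomorphic_on UNIV" "R holomorphic_on UNIV"
  shows "elim_coeff \<eta> \<beta> \<gamma> P R i holomorphic_on UNIV"
proof -
  have If: "(\<lambda>z. if c then a z else b z) holomorphic_on UNIV"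
    if "a holomorphic_on UNIV" "b holomorphic_on UNIV" for c and a b :: "complex \<Rightarrow> complex"
    using that by (cases c) auto
  have "(\<lambda>z. elim_coeff \<eta> \<beta> \<gamma> P R i z) holomorphic_on UNIV"
    unfolding elim_coeff_def Let_def by (intro If holomorphic_intros assms open_UNIV)
  then show ?thesis by simp
qed

text \<open>
  If some coefficient of the cubic is not identically zero, truncating at the highest such
  coefficient leaves an equation of positive degree, since an equation of degree 0 would say that this
  coefficient vanishes identically.
\<close>

lemma elimination_dichotomy:
  assumes hol: "\<beta> holomorphic_on UNIV" "\<gamma> holomorphic_on UNIV" "P holomorphic_on UNIV" "R holomorphic_on UNIV"
    and \<eta>: "\<eta> \<noteq> 0"
    and rel: "\<And>z. P z * exp (\<beta> z) * (exp (\<beta> z) + \<eta>) = R z * exp (\<gamma> z) * (exp (\<gamma> z) + \<eta>)"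
    and nz: "P z1 \<noteq> 0" "R z2 \<noteq> 0" "deriv \<beta> z3 \<noteq> 0" "deriv \<gamma> z4 \<noteq> 0"
  shows "(\<forall>z. deriv \<beta> z = deriv \<gamma> z \<and> P z = R z) \<or>
    (\<exists>d. 1 \<le> d \<and> d \<le> 3 \<and> (\<exists>z. elim_coeff \<eta> \<beta> \<gamma> P R d z \<noteq> 0) \<and>
       (\<forall>z. (\<Sum>i\<le>d. elim_coeff \<eta> \<beta> \<gamma> P R i z * exp (\<beta> z) ^ i) = 0))"
proof -
  let ?c = "elim_coeff \<eta> \<beta> \<gamma> P R"
  show ?thesis
  proof (cases "\<forall>i\<le>3. \<forall>z. ?c i z = 0")
    case True
    define M where "M z = (P z * R z) * (deriv \<beta> z * deriv \<gamma> z)" for z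
    have hold: "deriv \<beta> holomorphic_on UNIV" "deriv \<gamma> holomorphic_on UNIV"
      using hol by (auto intro: holomorphic_deriv)
    have holPR: "(\<lambda>z. P z * R z) holomorphic_on UNIV"
      and holdd: "(\<lambda>z. deriv \<beta> z * deriv \<gamma> z) holomorphic_on UNIV"
      using hol hold by (auto intro!: holomorphic_intros)
    obtain z5 where 5: "P z5 * R z5 \<noteq> 0"
      using entire_common_nonzero[OF hol(3,4) nz(1,2)] by (metis mult_eq_0_iff)
    obtain z6 where 6: "deriv \<beta> z6 * deriv \<gamma> z6 \<noteq> 0"
      using entire_common_nonzero[OF hold nz(3,4)] by (metis mult_eq_0_iff)
    obtain z7 where 7: "M z7 \<noteq> 0"
      using entire_common_nonzero[OF holPR holdd 5 6] unfolding M_def by (metis mult_eq_0_iff)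
    have holM: "M holomorphic_on UNIV"
      unfolding M_def by (intro holomorphic_intros hol hold)
    have eq: "deriv \<beta> z = deriv \<gamma> z \<and> P z = R z" if "M z \<noteq> 0" for z
      using elim_coeffs_zero[OF \<eta>, of P z R \<beta> \<gamma>] that True by (auto simp: M_def)
    have "(\<forall>z. M z = 0) \<or> (\<forall>z. deriv \<beta> z - deriv \<gamma> z = 0)"
      by (rule entire_mult_eq_0[OF holM]) (use eq hold in \<open>auto intro!: holomorphic_intros\<close>)
    moreover have "(\<forall>z. M z = 0) \<or> (\<forall>z. P z - R z = 0)"
      by (rule entire_mult_eq_0[OF holM]) (use eq hol in \<open>auto intro!: holomorphic_intros\<close>)
    ultimately show ?thesis using 7 by auto
  next
    case False
    define S where "S = {i. i \<le> 3 \<and> (\<exists>z. ?c i z \<noteq> 0)}"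
    have fin: "finite S" and ne: "S \<noteq> {}" using False by (auto simp: S_def)
    define d where "d = Max S"
    have dS: "d \<in> S" unfolding d_def using fin ne by (rule Max_in)
    have above: "?c i z = 0" if "d < i" "i \<le> 3" for i z
    proof -
      have "i \<notin> S" using Max_ge[OF fin, of i] that(1) by (auto simp: d_def)
      then show ?thesis using that(2) by (auto simp: S_def)
    qed
    have sum: "(\<Sum>i\<le>d. ?c i z * exp (\<beta> z) ^ i) = 0" for z
    proof -
      have "(\<Sum>i\<le>d. ?c i z * exp (\<beta> z) ^ i) = (\<Sum>i\<le>3. ?c i z * exp (\<beta> z) ^ i)"
        by (rule sum.mono_neutral_left) (use above dS in \<open>auto simp: S_def not_le\<close>)
      then show ?thesis using elimination[OF hol rel] by simp
    qed
    have "d \<noteq> 0"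
    proof
      assume "d = 0"
      then have "?c d z = 0" for z using sum[of z] by simp
      then show False using dS by (auto simp: S_def)
    qed
    then show ?thesis using dS sum by (intro disjI2 exI[of _ d]) (auto simp: S_def)
  qed
qed

text \<open>
  A special case of Borel's theorem on exponential sums with small coefficients. Otherwise \<open>exp \<beta>\<close>
  and, by symmetry, \<open>exp \<gamma>\<close> would both be algebraic over the small functions, so that the common
  majorant \<open>Y\<close> of \<open>\<beta>\<close> and \<open>\<gamma>\<close> would be of size \<open>log Y\<close> at a slightly larger radius. Treating \<open>\<beta>\<close> and
  \<open>\<gamma>\<close> simultaneously avoids comparing their growth. The two leading coefficients must not vanish at
  the common centre \<open>z0\<close>, which is why \<open>z0\<close> is chosen only at this stage.
\<close>

lemma exp_relation_rigid:
  assumes hol: "\<beta> holomorphic_on UNIV" "\<gamma> holomorphic_on UNIV" "P holomorphic_on UNIV" "R holomorphic_on UNIV"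
    and \<eta>: "\<eta> \<noteq> 0"
    and rel: "\<And>z. P z * exp (\<beta> z) * (exp (\<beta> z) + \<eta>) = R z * exp (\<gamma> z) * (exp (\<gamma> z) + \<eta>)"
    and nz: "P z1 \<noteq> 0" "R z2 \<noteq> 0" "deriv \<beta> z3 \<noteq> 0" "deriv \<gamma> z4 \<noteq> 0"
    and small: "\<And>Y z0. (\<And>r. r \<ge> 0 \<Longrightarrow> Y r \<ge> 1) \<Longrightarrow> (\<And>r s. 0 \<le> r \<Longrightarrow> r \<le> s \<Longrightarrow> Y r \<le> Y s) \<Longrightarrow>
       small_wrt Y z0 \<beta> \<Longrightarrow> small_wrt Y z0 \<gamma> \<Longrightarrow> small_wrt Y z0 P \<and> small_wrt Y z0 R"
  shows "deriv \<beta> z = deriv \<gamma> z \<and> P z = R z"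
proof (rule ccontr)
  assume contra: "\<not> ?thesis"
  from elimination_dichotomy[OF hol \<eta> rel nz] contra
  obtain d where d: "1 \<le> d" "d \<le> 3" "\<exists>z. elim_coeff \<eta> \<beta> \<gamma> P R d z \<noteq> 0"
    "\<And>z. (\<Sum>i\<le>d. elim_coeff \<eta> \<beta> \<gamma> P R i z * exp (\<beta> z) ^ i) = 0" by blast
  from elimination_dichotomy[OF hol(2,1,4,3) \<eta> rel[symmetric] nz(2,1,4,3)] contra
  obtain e where e: "1 \<le> e" "e \<le> 3" "\<exists>z. elim_coeff \<eta> \<gamma> \<beta> R P e z \<noteq> 0"
    "\<And>z. (\<Sum>i\<le>e. elim_coeff \<eta> \<gamma> \<beta> R P i z * exp (\<gamma> z) ^ i) = 0" by metis
  obtain z0 where z0: "elim_coeff \<eta> \<beta> \<gamma> P R d z0 \<noteq> 0" "elim_coeff \<eta> \<gamma> \<beta> R P e z0 \<noteq> 0"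
    using d(3) e(3) entire_common_nonzero[OF elim_coeff_holomorphic[OF hol]
        elim_coeff_holomorphic[OF hol(2,1,4,3)]] by metis
  define \<mu> where "\<mu> z = norm (\<beta> z) + norm (\<gamma> z)" for z
  define Y where "Y r = 1 + Sup (\<mu> ` cball z0 r)" for r
  have cont: "continuous_on UNIV \<mu>"
    unfolding \<mu>_def using hol by (intro continuous_intros holomorphic_on_imp_continuous_on)
  have bdd: "bdd_above (\<mu> ` cball z0 r)" for r
    by (intro bounded_imp_bdd_above compact_imp_bounded compact_continuous_image
        continuous_on_subset[OF cont] compact_cball) auto
  have \<mu>Y: "1 + \<mu> z \<le> Y r" if "z \<in> cball z0 r" for z r
    unfolding Y_def using that by (intro add_left_mono cSup_upper bdd) auto
  have \<mu>0: "\<mu> z \<ge> 0" for z by (simp add: \<mu>_def)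
  have Y1: "Y r \<ge> 1" if "r \<ge> 0" for r
    using \<mu>Y[of z0 r] \<mu>0[of z0] that by simp
  have Ymono: "Y r \<le> Y s" if "0 \<le> r" "r \<le> s" for r s
    unfolding Y_def using that by (intro add_left_mono cSup_subset_mono bdd) auto
  have sb: "small_wrt Y z0 \<beta>"
  proof (rule small_wrt_majorized[OF Y1 Ymono hol(1)])
    show "norm (\<beta> z) \<le> Y r" if "z \<in> cball z0 r" for r z
      using \<mu>Y[OF that] norm_ge_zero[of "\<gamma> z"] unfolding \<mu>_def by linarith
  qed
  have sg: "small_wrt Y z0 \<gamma>"
  proof (rule small_wrt_majorized[OF Y1 Ymono hol(2)])
    show "norm (\<gamma> z) \<le> Y r" if "z \<in> cball z0 r" for r z
      using \<mu>Y[OF that] norm_ge_zero[of "\<beta> z"] unfolding \<mu>_def by linarith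
  qed
  have sP: "small_wrt Y z0 P" and sR: "small_wrt Y z0 R"
    using small[of Y z0, OF Y1 Ymono sb sg] by blast+
  obtain C where C: "C \<ge> 0" "\<And>r \<delta> z. r \<ge> 1 \<Longrightarrow> \<delta> > 0 \<Longrightarrow> z \<in> cball z0 r \<Longrightarrow>
    norm (\<beta> z) \<le> C * (1 + r / \<delta>) * (1 + ln (Y (r + 2 * \<delta>) * (1 + 1 / \<delta>)))"
    using algebraic_over_small_bound[OF Y1 Ymono hol(1) elim_coeff_small[OF Y1 Ymono sb sg sP sR] d(4,1) z0(1)]
    by metis
  obtain D where D: "D \<ge> 0" "\<And>r \<delta> z. r \<ge> 1 \<Longrightarrow> \<delta> > 0 \<Longrightarrow> z \<in> cball z0 r \<Longrightarrow>
    norm (\<gamma> z) \<le> D * (1 + r / \<delta>) * (1 + ln (Y (r + 2 * \<delta>) * (1 + 1 / \<delta>)))"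
    using algebraic_over_small_bound[OF Y1 Ymono hol(2) elim_coeff_small[OF Y1 Ymono sg sb sR sP] e(4,1) z0(2)]
    by metis
  show False
  proof (rule log_growth_contradiction[of Y "1 + C + D"])
    show "\<exists>r\<ge>1. N \<le> Y r" for N
    proof (rule ccontr)
      assume "\<not> ?thesis"
      then have less: "\<And>r. r \<ge> 1 \<Longrightarrow> Y r < N" by (meson not_le)
      have "norm (\<beta> z) \<le> N" for z
      proof -
        have "1 + \<mu> z \<le> Y (max 1 (dist z0 z))" by (rule \<mu>Y) simp
        also have "\<dots> < N" by (rule less) simp
        finally show ?thesis using norm_ge_zero[of "\<gamma> z"] unfolding \<mu>_def by linarith
      qed
      then have "bounded (range \<beta>)" by (auto simp: bounded_iff)
      then have "\<beta> constant_on UNIV" using Liouville_theorem[OF hol(1)] by (auto simp: constant_on_def)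
      then obtain c where "\<beta> = (\<lambda>_. c)" by (auto simp: constant_on_def)
      then show False using nz(3) by simp
    qed
    fix r \<delta> :: real assume *: "1 \<le> r" "0 < \<delta>"
    define X where "X = (1 + r / \<delta>) * (1 + ln (Y (r + 2 * \<delta>) * (1 + 1 / \<delta>)))"
    have "Y (r + 2 * \<delta>) * (1 + 1 / \<delta>) \<ge> 1"
      using mult_mono[of 1 "Y (r + 2 * \<delta>)" 1 "1 + 1 / \<delta>"] Y1[of "r + 2 * \<delta>"] * by simp
    then have "ln (Y (r + 2 * \<delta>) * (1 + 1 / \<delta>)) \<ge> 0" by simp
    then have X: "X \<ge> 1"
      using mult_mono[of 1 "1 + r / \<delta>" 1 "1 + ln (Y (r + 2 * \<delta>) * (1 + 1 / \<delta>))"] *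
      by (simp add: X_def)
    have "\<mu> z \<le> (C + D) * X" if "z \<in> cball z0 r" for z
      using C(2)[OF * that] D(2)[OF * that] unfolding \<mu>_def X_def distrib_right mult.assoc by linarith
    then have "Sup (\<mu> ` cball z0 r) \<le> (C + D) * X"
      using * by (intro cSup_least) auto
    then have "Y r \<le> (1 + C + D) * X" using X by (simp add: Y_def algebra_simps)
    then show "Y r \<le> (1 + C + D) * (1 + r / \<delta>) * (1 + ln (Y (r + 2 * \<delta>) * (1 + 1 / \<delta>)))"
      by (simp add: X_def mult.assoc)
  qed (use C D Ymono in auto)
qed

primrec exp_deriv_factor :: "(complex \<Rightarrow> complex) \<Rightarrow> nat \<Rightarrow> complex \<Rightarrow> complex" where
  "exp_deriv_factor \<beta> 0 = (\<lambda>z. 1)"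
| "exp_deriv_factor \<beta> (Suc j) = (\<lambda>z. deriv (exp_deriv_factor \<beta> j) z + deriv \<beta> z * exp_deriv_factor \<beta> j z)"

lemma exp_deriv_factor_holomorphic:
  assumes "\<beta> holomorphic_on UNIV"
  shows "exp_deriv_factor \<beta> j holomorphic_on UNIV"
proof (induction j)
  case (Suc j)
  then show ?case
    unfolding exp_deriv_factor.simps by (intro holomorphic_intros assms open_UNIV)
qed simp

lemma higher_deriv_exp:
  assumes hol: "\<beta> holomorphic_on UNIV"
  shows "(deriv ^^ j) (\<lambda>z. exp (\<beta> z)) z = exp_deriv_factor \<beta> j z * exp (\<beta> z)"
proof (induction j arbitrary: z)
  case (Suc j)
  have D: "(h has_field_derivative deriv h z) (at z)" if "h holomorphic_on UNIV" for h
    using holomorphic_derivI[OF that open_UNIV UNIV_I] .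
  have "(deriv ^^ j) (\<lambda>z. exp (\<beta> z)) = (\<lambda>z. exp_deriv_factor \<beta> j z * exp (\<beta> z))"
    using Suc by blast
  moreover have "((\<lambda>z. exp_deriv_factor \<beta> j z * exp (\<beta> z)) has_field_derivative
      exp_deriv_factor \<beta> (Suc j) z * exp (\<beta> z)) (at z)"
    using D[OF exp_deriv_factor_holomorphic[OF hol, of j]] D[OF hol]
    by (auto intro!: derivative_eq_intros simp: algebra_simps)
  ultimately show ?case by (simp add: DERIV_imp_deriv)
qed simp

lemma higher_deriv_const_plus:
  assumes "h holomorphic_on UNIV" "k > 0"
  shows "(deriv ^^ k) (\<lambda>z. c + h z) z = (deriv ^^ k) h z"
proof -
  have "(deriv ^^ k) (\<lambda>z. c + h z) z = (deriv ^^ k) (\<lambda>z. c) z + (deriv ^^ k) h z"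
    by (rule higher_deriv_add[of _ UNIV]) (use assms in auto)
  then show ?thesis using assms by (simp add: higher_deriv_const)
qed

lemma exp_deriv_factor_shift:
  "exp_deriv_factor (\<lambda>z. \<beta> (z + c)) j = (\<lambda>z. exp_deriv_factor \<beta> j (z + c))"
proof (induction j)
  case (Suc j)
  have "deriv (\<lambda>z. h (z + c)) z = deriv h (z + c)" for h :: "complex \<Rightarrow> complex" and z
    using higher_deriv_shift[of 1 h c] by (simp add: fun_eq_iff)
  then show ?case using Suc by simp
qed simp

lemma exp_deriv_factor_small:
  assumes "\<And>r. r \<ge> 0 \<Longrightarrow> Y r \<ge> 1" "\<And>r s. 0 \<le> r \<Longrightarrow> r \<le> s \<Longrightarrow> Y r \<le> Y s" "small_wrt Y z0 \<beta>"
  shows "small_wrt Y z0 (exp_deriv_factor \<beta> j)"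
proof (induction j)
  case (Suc j)
  show ?case
    unfolding exp_deriv_factor.simps by (intro small_wrt_intros[OF assms(1,2)] assms(3) Suc)
qed (simp add: small_wrt_const[OF assms(1,2)])

text \<open>
  Here \<open>f = \<eta> + exp \<beta>\<close> and \<open>f\<^sup>(\<^sup>k\<^sup>) = P exp \<beta>\<close> with a differential polynomial \<open>P\<close> in \<open>\<beta>\<close>; for the
  translate these are \<open>\<gamma>\<close> and \<open>R\<close>. Rigidity yields \<open>\<beta>' = \<gamma>'\<close> and \<open>P = R\<close>, so that
  \<open>u (u + \<eta>) = v (v + \<eta>)\<close>. The case \<open>u + v = - \<eta>\<close> is impossible, as differentiation would give
  \<open>\<beta>' (u + v) = 0\<close>.
\<close>

lemma entire_periodic_if_omits_value:
  assumes hol: "f holomorphic_on UNIV" and k: "k > 0" and \<eta>: "\<eta> \<noteq> 0"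
    and omit: "\<And>z. f z \<noteq> \<eta>" and dk: "(deriv ^^ k) f z1 \<noteq> 0"
    and per: "\<And>z. f (z + c) * (deriv ^^ k) f (z + c) = f z * (deriv ^^ k) f z"
  shows "f (z + c) = f z"
proof -
  have "(\<lambda>z. f z - \<eta>) holomorphic_on UNIV" by (intro holomorphic_intros hol)
  then obtain \<beta> where hol\<beta>: "\<beta> holomorphic_on UNIV" and "\<And>z. exp (\<beta> z) = f z - \<eta>"
    using holomorphic_logarithm_exists[of UNIV "\<lambda>z. f z - \<eta>" 0] omit by auto
  then have f: "f = (\<lambda>z. \<eta> + exp (\<beta> z))" by (simp add: fun_eq_iff)
  define \<gamma> where "\<gamma> z = \<beta> (z + c)" for z
  define P where "P = exp_deriv_factor \<beta> k"
  define R where "R = exp_deriv_factor \<gamma> k"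
  have hol\<gamma>: "\<gamma> holomorphic_on UNIV"
  proof -
    have "(\<beta> \<circ> (\<lambda>z. z + c)) holomorphic_on UNIV"
      by (rule holomorphic_on_compose_gen[OF _ hol\<beta>]) (auto intro!: holomorphic_intros)
    then show ?thesis by (simp add: \<gamma>_def[abs_def] o_def)
  qed
  have holP: "P holomorphic_on UNIV" and holR: "R holomorphic_on UNIV"
    unfolding P_def R_def by (intro exp_deriv_factor_holomorphic hol\<beta> hol\<gamma>)+
  have R: "R z = P (z + c)" for z
    using exp_deriv_factor_shift[of \<beta> c k] by (simp add: R_def P_def \<gamma>_def[abs_def])
  have dkf: "(deriv ^^ k) f z = P z * exp (\<beta> z)" for z
  proof -
    have "(\<lambda>z. exp (\<beta> z)) holomorphic_on UNIV" by (intro holomorphic_intros hol\<beta>)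
    from higher_deriv_const_plus[OF this k, of \<eta> z] show ?thesis
      by (simp add: f P_def higher_deriv_exp[OF hol\<beta>])
  qed
  have rel: "P z * exp (\<beta> z) * (exp (\<beta> z) + \<eta>) = R z * exp (\<gamma> z) * (exp (\<gamma> z) + \<eta>)" for z
    using per[of z] unfolding dkf R by (simp add: f \<gamma>_def mult_ac add.commute)
  have Pz: "P z1 \<noteq> 0" using dk by (simp add: dkf)
  have Rz: "R (z1 - c) \<noteq> 0" using Pz by (simp add: R)
  have d\<gamma>: "deriv \<gamma> z = deriv \<beta> (z + c)" for z
    using higher_deriv_shift[of 1 \<beta> c] by (simp add: \<gamma>_def[abs_def] fun_eq_iff)
  obtain z3 where z3: "deriv \<beta> z3 \<noteq> 0"
  proof (rule ccontr)
    assume "\<not> thesis"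
    then have "\<And>z. deriv \<beta> z = 0" using that by blast
    then have "(\<beta> has_field_derivative 0) (at z)" for z
      using holomorphic_derivI[OF hol\<beta> open_UNIV UNIV_I, of z] by simp
    then have "\<beta> constant_on UNIV"
      by (intro has_field_derivative_0_imp_constant_on) auto
    then obtain b where "\<beta> = (\<lambda>_. b)" by (auto simp: constant_on_def)
    then have "f = (\<lambda>_. \<eta> + exp b)" by (simp add: f)
    then show False using dk k by (simp add: higher_deriv_const)
  qed
  have z4: "deriv \<gamma> (z3 - c) \<noteq> 0" using z3 by (simp add: d\<gamma>)
  have rigid: "deriv \<beta> z = deriv \<gamma> z \<and> P z = R z" for z
  proof (rule exp_relation_rigid[OF hol\<beta> hol\<gamma> holP holR \<eta> rel Pz Rz z3 z4])
    fix Y z0 assume Y: "\<And>r. r \<ge> 0 \<Longrightarrow> Y r \<ge> (1::real)" "\<And>r s. 0 \<le> r \<Longrightarrow> r \<le> s \<Longrightarrow> Y r \<le> Y s"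
      and "small_wrt Y z0 \<beta>" "small_wrt Y z0 \<gamma>"
    then show "small_wrt Y z0 P \<and> small_wrt Y z0 R"
      unfolding P_def R_def by (intro conjI exp_deriv_factor_small[of Y] Y) auto
  qed
  define u v where "u z = exp (\<beta> z)" and "v z = exp (\<gamma> z)" for z
  have holu: "u holomorphic_on UNIV" "v holomorphic_on UNIV"
    unfolding u_def v_def by (intro holomorphic_intros hol\<beta> hol\<gamma>)+
  have "P z * ((u z - v z) * (u z + v z + \<eta>)) = 0" for z
    using rel[of z] rigid[of z] by (simp add: u_def v_def algebra_simps)
  then have "(\<forall>z. P z = 0) \<or> (\<forall>z. (u z - v z) * (u z + v z + \<eta>) = 0)"
    by (intro entire_mult_eq_0 holomorphic_intros holP holu)
  then have "(\<forall>z. u z - v z = 0) \<or> (\<forall>z. u z + v z + \<eta> = 0)"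
    using Pz by (intro entire_mult_eq_0 holomorphic_intros holu) auto
  moreover have "\<not> (\<forall>z. u z + v z + \<eta> = 0)"
  proof
    assume *: "\<forall>z. u z + v z + \<eta> = 0"
    have "((\<lambda>z. u z + v z + \<eta>) has_field_derivative u z3 * deriv \<beta> z3 + v z3 * deriv \<gamma> z3) (at z3)"
      unfolding u_def v_def using holomorphic_derivI[OF hol\<beta> open_UNIV UNIV_I, of z3]
        holomorphic_derivI[OF hol\<gamma> open_UNIV UNIV_I, of z3]
      by (auto intro!: derivative_eq_intros)
    moreover have "(\<lambda>z. u z + v z + \<eta>) = (\<lambda>_. 0)" using * by blast
    ultimately have "u z3 * deriv \<beta> z3 + v z3 * deriv \<gamma> z3 = 0"
      using DERIV_unique[OF _ DERIV_const] by metis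
    then have "(u z3 + v z3) * deriv \<beta> z3 = 0" using rigid[of z3] by (simp add: distrib_right)
    then have "u z3 + v z3 = 0" using z3 by simp
    then show False using * \<eta> by (metis add_0)
  qed
  ultimately have "u z = v z" by simp
  then show ?thesis by (simp add: f u_def v_def \<gamma>_def)
qed

lemma rational_if_higher_deriv_zero:
  assumes hol: "f holomorphic_on UNIV" and zero: "\<And>z. (deriv ^^ k) f z = 0"
  shows "rational_fun f"
proof -
  define p where "p = (\<Sum>n<k. monom ((deriv ^^ n) f 0 / fact n) n)"
  have zero': "(deriv ^^ n) f 0 = 0" if n: "n \<ge> k" for n
  proof -
    have "(deriv ^^ (m + k)) f z = 0" for m z
    proof (induction m arbitrary: z)
      case (Suc m)
      then have "(deriv ^^ (m + k)) f = (\<lambda>_. 0)" by blast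
      then show ?case by simp
    qed (use zero in simp)
    from this[of "n - k"] n show ?thesis by simp
  qed
  have "f z = poly p z" for z
  proof -
    have "(\<lambda>n. (deriv ^^ n) f 0 / fact n * (z - 0) ^ n) sums f z"
      by (rule holomorphic_power_series[of _ _ "norm z + 1"]) (use hol holomorphic_on_subset in auto)
    moreover have "(\<lambda>n. (deriv ^^ n) f 0 / fact n * (z - 0) ^ n) sums
        (\<Sum>n<k. (deriv ^^ n) f 0 / fact n * (z - 0) ^ n)"
      by (rule sums_finite) (use zero' in auto)
    ultimately show ?thesis
      by (simp add: p_def poly_sum poly_monom sums_unique2)
  qed
  then show ?thesis unfolding rational_fun_def by (intro exI[of _ p] exI[of _ 1]) auto
qed

section \<open>The periodicity theorem\<close>

lemma holomorphic_if_no_poles: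
  assumes "f nicely_meromorphic_on UNIV" "\<And>z. \<not> is_pole f z"
  shows "f holomorphic_on UNIV"
proof -
  have "f analytic_on UNIV"
    unfolding analytic_on_analytic_at[of f UNIV]
    using nicely_meromorphic_on_imp_analytic_at[OF assms(1)] assms(2) by simp
  then show ?thesis by (rule analytic_imp_holomorphic)
qed

lemma entire_eq_if_eq_cosparse:
  assumes "g holomorphic_on UNIV" "h holomorphic_on UNIV" "\<forall>\<^sub>\<approx>z\<in>UNIV. g z = h z"
  shows "g z = (h z :: complex)"
proof -
  have lim: "(g \<longlongrightarrow> g z) (at z)" "(h \<longlongrightarrow> h z) (at z)"
    using assms(1,2)[THEN holomorphic_on_imp_continuous_on]
    by (auto simp: continuous_on_eq_continuous_at isCont_def)
  have "eventually (\<lambda>w. g w = h w) (at z)"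
    using eventually_cosparse_imp_eventually_at[OF assms(3), of z UNIV] by simp
  with lim(1) have "(h \<longlongrightarrow> g z) (at z)" by (simp add: tendsto_cong)
  then show ?thesis using lim(2) by (rule tendsto_unique[OF at_neq_bot])
qed

theorem theorem1p1:
  fixes f :: "complex \<Rightarrow> complex" and k :: nat
  assumes "transcendental_meromorphic f"
    and "\<exists>\<eta>. \<eta> \<noteq> 0 \<and> picard_exceptional f \<eta>"
    and "k > 0"
    and "periodic_meromorphic (\<lambda>z. f z * (deriv ^^ k) f z)"
  shows "periodic_meromorphic f"
proof -
  have nice: "f nicely_meromorphic_on UNIV" and trans: "\<not> rational_fun f"
    using assms(1) by (auto simp: transcendental_meromorphic_def)
  obtain \<eta> where \<eta>: "\<eta> \<noteq> 0" "picard_exceptional f \<eta>" using assms(2) by blast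
  obtain c where c: "c \<noteq> 0"
    and per: "\<forall>\<^sub>\<approx>z\<in>UNIV. f (z + c) * (deriv ^^ k) f (z + c) = f z * (deriv ^^ k) f z"
    using assms(4) unfolding periodic_meromorphic_def by blast
  show ?thesis
  proof (cases "\<exists>z0. is_pole f z0")
    case True
    then show ?thesis using periodic_if_pole[OF nice \<eta> assms(3) c per] by blast
  next
    case False
    then have hol: "f holomorphic_on UNIV" using holomorphic_if_no_poles[OF nice] by blast
    obtain z1 where z1: "(deriv ^^ k) f z1 \<noteq> 0"
      using rational_if_higher_deriv_zero[OF hol] trans by blast
    define H where "H z = f z * (deriv ^^ k) f z" for z
    have holH: "H holomorphic_on UNIV"
      unfolding H_def by (intro holomorphic_intros hol holomorphic_higher_deriv open_UNIV)
    have "(H \<circ> (\<lambda>z. z + c)) holomorphic_on UNIV"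
      by (rule holomorphic_on_compose_gen[OF _ holH]) (auto intro!: holomorphic_intros)
    then have "(\<lambda>z. H (z + c)) holomorphic_on UNIV" by (simp add: o_def)
    then have "H (z + c) = H z" for z
      by (rule entire_eq_if_eq_cosparse[OF _ holH]) (use per in \<open>simp add: H_def\<close>)
    then have "f (z + c) = f z" for z
      using entire_periodic_if_omits_value[OF hol assms(3) \<eta>(1) _ z1, of c] \<eta>(2) False
      by (simp add: H_def picard_exceptional_def)
    then have "\<forall>\<^sub>\<approx>z\<in>UNIV. f (z + c) = f z" by simp
    then show ?thesis
      using nice c unfolding periodic_meromorphic_def nicely_meromorphic_on_def by blast
  qed
qed

end
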